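(* Let $G$ be a finite abelian group of rank $n$ which is not elementary abelian. Then $\tau(G)=n+1$.
   Context: The rank is the minimal number of generators; an elementary abelian group is one isomorphic to $(\mathbb{Z}/p\mathbb{Z})^m$ for a prime $p$. A projective representation of $G$ is an $\alpha$-representation for some cocycle $\alpha$: a map $\rho:G\to\mathrm{GL}_m(\mathbb{C})$ with $\rho(1)=I$ and $\rho(g)\rho(h)=\alpha(g,h)\rho(gh)$; it is faithful if the only $g$ with $\rho(g)$ scalar is $g=1$. $\tau(G)$ is the least degree of a faithful projective representation of $G$. *)

theory Defs
  imports "HOL-Algebra.Algebra" "Jordan_Normal_Form.Matrix"
begin

definition group_rank :: "('a, 'b) monoid_scheme \<Rightarrow> nat" where
  "group_rank G = (LEAST n. \<exists>S. S \<subseteq> carrier G \<and> finite S \<and> card S = n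
                              \<and> generate G S = carrier G)"

definition elementary_abelian :: "('a, 'b) monoid_scheme \<Rightarrow> bool" where
  "elementary_abelian G \<longleftrightarrow>
     (\<exists>(p::nat) (m::nat). Factorial_Ring.prime p \<and> G \<cong> product_group {..<m} (\<lambda>_. integer_mod_group p))"

definition proj_rep ::
  "('a, 'b) monoid_scheme \<Rightarrow> nat \<Rightarrow> ('a \<Rightarrow> 'a \<Rightarrow> complex) \<Rightarrow> ('a \<Rightarrow> complex mat) \<Rightarrow> bool" where
  "proj_rep G m \<alpha> \<rho> \<longleftrightarrow>
     (\<forall>g\<in>carrier G. \<forall>h\<in>carrier G. \<alpha> g h \<noteq> 0) \<and>
     (\<forall>g\<in>carrier G. \<forall>h\<in>carrier G. \<forall>k\<in>carrier G.
         \<alpha> g h * \<alpha> (g \<otimes>\<^bsub>G\<^esub> h) k = \<alpha> h k * \<alpha> g (h \<otimes>\<^bsub>G\<^esub> k)) \<and>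
     (\<forall>g\<in>carrier G. \<rho> g \<in> carrier_mat m m \<and> invertible_mat (\<rho> g)) \<and>
     \<rho> \<one>\<^bsub>G\<^esub> = 1\<^sub>m m \<and>
     (\<forall>g\<in>carrier G. \<forall>h\<in>carrier G. \<rho> g * \<rho> h = \<alpha> g h \<cdot>\<^sub>m \<rho> (g \<otimes>\<^bsub>G\<^esub> h))"

definition faithful_proj_rep ::
  "('a, 'b) monoid_scheme \<Rightarrow> nat \<Rightarrow> ('a \<Rightarrow> complex mat) \<Rightarrow> bool" where
  "faithful_proj_rep G m \<rho> \<longleftrightarrow>
     (\<forall>g\<in>carrier G. (\<exists>c::complex. \<rho> g = c \<cdot>\<^sub>m 1\<^sub>m m) \<longrightarrow> g = \<one>\<^bsub>G\<^esub>)"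

definition tau :: "('a, 'b) monoid_scheme \<Rightarrow> nat" where
  "tau G = (LEAST m. m \<ge> 1 \<and> (\<exists>\<alpha> \<rho>. proj_rep G m \<alpha> \<rho> \<and> faithful_proj_rep G m \<rho>))"

end

theory Submission
  imports Defs "Jordan_Normal_Form.Spectral_Radius"
begin

text \<open>
  For the upper bound, evaluation at \<open>n\<close> generators of \<open>G\<close> separates the points of the dual group, so
  the dual is generated by \<open>n\<close> characters; these separate the points of \<open>G\<close>, and their direct sum
  with the trivial character is a faithful projective representation.

  For the lower bound, let \<open>\<beta>(g, h) = \<alpha>(g, h) / \<alpha>(h, g)\<close> be the commutator form of a faithful
  representation of degree \<open>m\<close> and \<open>L\<close> a maximal isotropic subgroup. The matrices \<open>\<rho>(g)\<close> for
  \<open>g\<close> in \<open>L\<close> are simultaneously diagonalisable, and \<open>G / L\<close> acts freely on the at most \<open>m\<close> joint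
  eigenvalue functions, say with \<open>r\<close> orbits, so \<open>r |G / L| \<le> m\<close>. If \<open>a\<close> elements generate \<open>G\<close>
  modulo \<open>L\<close>, then faithfulness shows that \<open>L\<close> is separated by \<open>a + r - 1\<close> characters, so
  \<open>n \<le> 2 a + r - 1\<close>, where \<open>a\<close> can be chosen with \<open>2 ^ a \<le> |G / L|\<close>. Hence \<open>m \<le> n\<close> is
  possible only for \<open>r = 1\<close> and \<open>2 ^ a = 2 a\<close>, and then \<open>n = 2 a\<close> and \<open>|G| \<le> 2 ^ n\<close>, which
  makes \<open>G\<close> elementary abelian.
\<close>

subsection \<open>Characters and generators of finite abelian groups\<close>

text \<open>Multiplication by an element \<open>z\<close> permutes \<open>M\<close>, so comparing
  products over \<open>M\<close> gives \<open>z ^ card M = 1\<close>. By counting, \<open>M\<close>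
  consists of all roots of unity of that order and is cyclic.\<close>

lemma finite_mult_closed_cyclic:
  fixes M :: "complex set"
  assumes fin: "finite M" and "0 \<notin> M" and "1 \<in> M"
    and closed: "\<And>x y. x \<in> M \<Longrightarrow> y \<in> M \<Longrightarrow> x * y \<in> M"
  shows "\<exists>w\<in>M. \<forall>z\<in>M. \<exists>j::nat. z = w ^ j"
proof -
  define N where "N = card M"
  have N: "N > 0"
    using assms by (auto simp: N_def card_gt_0_iff)
  have root: "z ^ N = 1" if z: "z \<in> M" for z
  proof -
    have inj: "inj_on ((*) z) M"
      using z assms by (auto simp: inj_on_def)
    have "(*) z ` M = M"
      using closed z inj by (intro endo_inj_surj fin) auto
    then have "\<Prod>M = (\<Prod>y\<in>M. z * y)"
      using prod.reindex[OF inj, of "\<lambda>y. y"] by (simp add: comp_def)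
    also have "\<dots> = z ^ N * \<Prod>M"
      by (simp add: prod.distrib N_def)
    finally show ?thesis
      using fin \<open>0 \<notin> M\<close> by auto
  qed
  have eq: "M = {z. z ^ N = 1}"
    using N root by (intro card_subset_eq) (auto simp: card_roots_unity_eq N_def finite_roots_unity)
  define w where "w = cis (2 * pi * real 1 / real N)"
  have "\<exists>j::nat. z = w ^ j" if "z \<in> M" for z
  proof -
    have "z \<in> (\<lambda>k. cis (2 * pi * real k / real N)) ` {..<N}"
      using bij_betw_imp_surj_on[OF bij_betw_roots_unity[OF N]] that eq by blast
    then obtain j :: nat where "z = cis (2 * pi * real j / real N)"
      by (rule imageE)
    then have "z = w ^ j"
      unfolding w_def Complex.DeMoivre by (simp add: mult.commute)
    then show ?thesis ..
  qed
  moreover have "w \<in> M"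
    using N unfolding eq w_def mem_Collect_eq Complex.DeMoivre by simp
  ultimately show ?thesis by blast
qed

text \<open>The conditions are relative to a set \<open>H\<close>, so that one total function serves
  as a character of a subgroup and of all its subgroups.\<close>

definition complex_char_on :: "('a, 'b) monoid_scheme \<Rightarrow> 'a set \<Rightarrow> ('a \<Rightarrow> complex) \<Rightarrow> bool" where
  "complex_char_on G H \<chi> \<longleftrightarrow>
     (\<forall>x\<in>H. \<chi> x \<noteq> 0) \<and> (\<forall>x\<in>H. \<forall>y\<in>H. \<chi> (x \<otimes>\<^bsub>G\<^esub> y) = \<chi> x * \<chi> y)"

lemma complex_char_on_subset:
  "complex_char_on G H \<chi> \<Longrightarrow> K \<subseteq> H \<Longrightarrow> complex_char_on G K \<chi>"
  by (auto simp: complex_char_on_def)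

lemma (in group) complex_char_on_one:
  assumes "complex_char_on G H \<chi>" "subgroup H G"
  shows "\<chi> \<one> = 1"
proof -
  have "\<one> \<in> H" using assms(2) by (rule subgroup.one_closed)
  then have "\<chi> \<one> * \<chi> \<one> = \<chi> \<one>" "\<chi> \<one> \<noteq> 0"
    using assms(1) unfolding complex_char_on_def by (metis l_one one_closed)+
  then show ?thesis by simp
qed

lemma (in group) subgroup_nat_pow_closed:
  assumes "subgroup H G" "x \<in> H"
  shows "x [^] (j::nat) \<in> H"
  by (induction j) (use assms in \<open>auto simp: subgroup.one_closed subgroup.m_closed\<close>)

lemma (in group) complex_char_on_pow:
  assumes "complex_char_on G H \<chi>" "subgroup H G" "x \<in> H"
  shows "x [^] (j::nat) \<in> H \<and> \<chi> (x [^] j) = \<chi> x ^ j"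
proof (induction j)
  case 0
  then show ?case using complex_char_on_one[OF assms(1,2)] assms(2) by (simp add: subgroup.one_closed)
next
  case (Suc j)
  then show ?case using assms unfolding complex_char_on_def by (simp add: subgroup.m_closed)
qed

lemma (in group) complex_char_on_inv:
  assumes "complex_char_on G H \<chi>" "subgroup H G" "x \<in> H"
  shows "\<chi> (inv x) = inverse (\<chi> x)"
proof -
  have "inv x \<in> H" "x \<in> carrier G"
    using assms subgroup.m_inv_closed subgroup.mem_carrier by metis+
  then have "\<chi> (inv x) * \<chi> x = 1"
    using assms complex_char_on_one[OF assms(1,2)] unfolding complex_char_on_def by (metis l_inv)
  then show ?thesis
    by (metis inverse_unique mult.commute)
qed

lemma (in group) subgroup_kernel_complex_char_on:
  assumes chi: "complex_char_on G H \<chi>" and H: "subgroup H G"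
  shows "subgroup {x\<in>H. \<chi> x = 1} G"
proof (rule subgroupI)
  show "{x\<in>H. \<chi> x = 1} \<noteq> {}"
    using complex_char_on_one[OF chi H] subgroup.one_closed[OF H] by blast
qed (use subgroup.subset[OF H] chi H complex_char_on_inv[OF chi H] in
    \<open>auto simp: complex_char_on_def subgroup.m_inv_closed subgroup.m_closed\<close>)

lemma (in group) complex_char_trivial_if_trivial_on_generators:
  assumes chi: "complex_char_on G (carrier G) \<chi>"
    and S: "S \<subseteq> carrier G" "generate G S = carrier G" and "\<And>s. s \<in> S \<Longrightarrow> \<chi> s = 1"
    and "x \<in> carrier G"
  shows "\<chi> x = 1"
proof -
  have "S \<subseteq> {x \<in> carrier G. \<chi> x = 1}" using assms(2,4) by blast
  then have "generate G S \<subseteq> {x \<in> carrier G. \<chi> x = 1}"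
    using subgroup_kernel_complex_char_on[OF chi subgroup_self] by (rule generate_subgroup_incl)
  then show ?thesis using S(2) assms(5) by blast
qed

text \<open>Induction on the number of characters: the kernel of one of them is handled by the others,
  and its image is a finite, hence cyclic, subgroup of the multiplicative group of the complex numbers.\<close>

lemma (in group) generated_by_card_separating_chars:
  assumes "finite C" and "finite H" and "subgroup H G"
    and "\<And>\<chi>. \<chi> \<in> C \<Longrightarrow> complex_char_on G H \<chi>"
    and "\<And>x. x \<in> H \<Longrightarrow> (\<And>\<chi>. \<chi> \<in> C \<Longrightarrow> \<chi> x = 1) \<Longrightarrow> x = \<one>"
  shows "\<exists>T. T \<subseteq> H \<and> finite T \<and> card T \<le> card C \<and> generate G T = H"
  using assms
proof (induction C arbitrary: H rule: finite_induct)
  case empty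
  then have "H = {\<one>}" using subgroup.one_closed by fastforce
  then show ?case by (intro exI[of _ "{}"]) (simp add: generate_empty)
next
  case (insert \<chi> C)
  have chi: "complex_char_on G H \<chi>" using insert.prems by simp
  have HG: "H \<subseteq> carrier G" using insert.prems(2) by (rule subgroup.subset)
  define K where "K = {h\<in>H. \<chi> h = 1}"
  have K: "subgroup K G"
    unfolding K_def by (rule subgroup_kernel_complex_char_on[OF chi insert.prems(2)])
  have "\<exists>T. T \<subseteq> K \<and> finite T \<and> card T \<le> card C \<and> generate G T = K"
  proof (rule insert.IH)
    show "finite K" using insert.prems by (simp add: K_def)
    show "complex_char_on G K \<psi>" if "\<psi> \<in> C" for \<psi>
      using insert.prems(3)[of \<psi>] that by (auto simp: complex_char_on_def K_def)
    show "x = \<one>" if "x \<in> K" "\<And>\<psi>. \<psi> \<in> C \<Longrightarrow> \<psi> x = 1" for x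
      using that insert.prems(4)[of x] by (auto simp: K_def)
  qed (rule K)
  then obtain T where T: "T \<subseteq> K" "finite T" "card T \<le> card C" "generate G T = K" by blast
  have "\<exists>w\<in>\<chi> ` H. \<forall>z\<in>\<chi> ` H. \<exists>j::nat. z = w ^ j"
  proof (rule finite_mult_closed_cyclic)
    show "1 \<in> \<chi> ` H"
      using complex_char_on_one[OF chi insert.prems(2)] subgroup.one_closed[OF insert.prems(2)]
      by force
    show "u * v \<in> \<chi> ` H" if "u \<in> \<chi> ` H" "v \<in> \<chi> ` H" for u v
    proof -
      from that obtain x y where xy: "x \<in> H" "y \<in> H" "u = \<chi> x" "v = \<chi> y"
        by (elim imageE) simp
      then have "u * v = \<chi> (x \<otimes> y)" "x \<otimes> y \<in> H"
        using chi insert.prems(2) by (auto simp: complex_char_on_def subgroup.m_closed)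
      then show ?thesis by blast
    qed
  qed (use insert.prems chi in \<open>auto simp: complex_char_on_def\<close>)
  then obtain x where x: "x \<in> H" "\<And>h. h \<in> H \<Longrightarrow> \<exists>j::nat. \<chi> h = \<chi> x ^ j" by blast
  have sub: "insert x T \<subseteq> H" using x T by (auto simp: K_def)
  have "h \<in> generate G (insert x T)" if h: "h \<in> H" for h
  proof -
    obtain j :: nat where j: "\<chi> h = \<chi> x ^ j" using x h by blast
    let ?y = "x [^] j"
    have y: "?y \<in> H" "\<chi> ?y = \<chi> x ^ j" using complex_char_on_pow[OF chi insert.prems(2) x(1)] by auto
    \<comment> \<open>Dividing \<open>h\<close> by the power of \<open>x\<close> with the same value
      of \<open>\<chi>\<close> leaves an element of the kernel \<open>K\<close>, which
      \<open>T\<close> generates.\<close>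
    have "h \<otimes> inv ?y \<in> K"
      using h y j chi insert.prems(2) complex_char_on_inv[OF chi insert.prems(2) y(1)]
      by (auto simp: K_def complex_char_on_def subgroup.m_closed subgroup.m_inv_closed)
    then have "h \<otimes> inv ?y \<in> generate G (insert x T)"
      using T(4) mono_generate[of T "insert x T"] by blast
    moreover have "?y \<in> generate G (insert x T)"
      using sub HG by (intro subgroup_nat_pow_closed generate_is_subgroup) (auto intro: generate.incl)
    ultimately have "(h \<otimes> inv ?y) \<otimes> ?y \<in> generate G (insert x T)"
      by (rule generate.eng)
    moreover have "(h \<otimes> inv ?y) \<otimes> ?y = h"
      using h y HG by (simp add: m_assoc subsetD)
    ultimately show ?thesis by simp
  qed
  moreover have "generate G (insert x T) \<subseteq> H"
    using generate_subgroup_incl[OF sub insert.prems(2)] .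
  ultimately have "generate G (insert x T) = H" by blast
  then show ?case
    using sub T insert.hyps by (intro exI[of _ "insert x T"]) (auto simp: card_insert_if)
qed

section \<open>Generating a group over a subgroup\<close>

lemma (in group) card_subgroup_mult_transversal_le:
  assumes H: "subgroup H G" and "K \<subseteq> carrier G" "finite K" and Y: "Y \<subseteq> carrier G"
    and in_K: "\<And>h y. h \<in> H \<Longrightarrow> y \<in> Y \<Longrightarrow> h \<otimes> y \<in> K"
    and sep: "\<And>y z. y \<in> Y \<Longrightarrow> z \<in> Y \<Longrightarrow> y \<otimes> inv z \<in> H \<Longrightarrow> y = z"
  shows "card H * card Y \<le> card K"
proof -
  have HG: "H \<subseteq> carrier G" using H by (rule subgroup.subset)
  \<comment> \<open>Equal products put \<open>y\<close> and \<open>y'\<close> into the same right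
    coset of \<open>H\<close>, and \<open>sep\<close> allows only one element of \<open>Y\<close>
    per coset.\<close>
  have "inj_on (\<lambda>(h, y). h \<otimes> y) (H \<times> Y)"
  proof (rule inj_onI, clarify)
    fix h y h' y' assume *: "h \<in> H" "y \<in> Y" "h' \<in> H" "y' \<in> Y" "h \<otimes> y = h' \<otimes> y'"
    then have c: "h \<in> carrier G" "y \<in> carrier G" "h' \<in> carrier G" "y' \<in> carrier G"
      using HG Y by auto
    have "y = inv h \<otimes> (h' \<otimes> y')"
      using c *(5) by (subst inv_solve_left) auto
    then have "y \<otimes> inv y' = inv h \<otimes> h'"
      using c by (simp add: m_assoc)
    also have "\<dots> \<in> H" using * H by (simp add: subgroup.m_closed subgroup.m_inv_closed)
    finally have "y = y'" using sep * by blast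
    then show "h = h' \<and> y = y'" using c *(5) by simp
  qed
  then have "card (H \<times> Y) \<le> card K"
    using assms(3) in_K by (intro card_inj_on_le) auto
  then show ?thesis by (simp add: card_cartesian_product)
qed

text \<open>Adjoining an element outside a subgroup at least doubles its order; this is repeated
  until all of \<open>G\<close> is reached.\<close>

lemma (in group) exists_small_complement_generators:
  assumes fin: "finite (carrier G)" and "subgroup H G"
  shows "\<exists>S. S \<subseteq> carrier G \<and> finite S \<and> generate G (H \<union> S) = carrier G
             \<and> card H * 2 ^ card S \<le> card (carrier G)"
  using assms(2)
proof (induction "card (carrier G) - card H" arbitrary: H rule: less_induct)
  case less
  have HG: "H \<subseteq> carrier G" using less.prems by (rule subgroup.subset)
  show ?case
  proof (cases "H = carrier G")
    case True
    then show ?thesis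
      using generateI[OF less.prems, of H] by (intro exI[of _ "{}"]) auto
  next
    case False
    then obtain x where x: "x \<in> carrier G" "x \<notin> H" using HG by blast
    define K where "K = generate G (insert x H)"
    have K: "subgroup K G" unfolding K_def using x HG by (intro generate_is_subgroup) auto
    have KG: "K \<subseteq> carrier G" using K by (rule subgroup.subset)
    have HK: "H \<subseteq> K" "x \<in> K" unfolding K_def by (auto intro: generate.incl)
    have "card H * card {\<one>, x} \<le> card K"
    proof (rule card_subgroup_mult_transversal_le[OF less.prems KG])
      show "finite K" using KG fin finite_subset by blast
      show "{\<one>, x} \<subseteq> carrier G" using x by simp
      show "h \<otimes> y \<in> K" if "h \<in> H" "y \<in> {\<one>, x}" for h y
        using that HK K subgroup.one_closed[OF K] by (auto intro!: subgroup.m_closed)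
      show "y = z" if "y \<in> {\<one>, x}" "z \<in> {\<one>, x}" "y \<otimes> inv z \<in> H" for y z
        using that x subgroup.m_inv_closed[OF less.prems, of "inv x"] by auto
    qed
    moreover have "x \<noteq> \<one>" using x less.prems subgroup.one_closed by auto
    ultimately have 2: "card H * 2 \<le> card K" by (simp add: card_insert_if eq_commute)
    have "card H > 0" using HG fin less.prems
      by (metis card_gt_0_iff empty_iff finite_subset subgroup.one_closed)
    moreover have "card K \<le> card (carrier G)" using KG fin by (rule card_mono[rotated])
    ultimately have "card (carrier G) - card K < card (carrier G) - card H" using 2 by linarith
    from less.hyps[OF this K] obtain S where
      S: "S \<subseteq> carrier G" "finite S" "generate G (K \<union> S) = carrier G"
         "card K * 2 ^ card S \<le> card (carrier G)" by blast
    have c: "H \<union> insert x S \<subseteq> carrier G" using HG x S by auto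
    have "K \<subseteq> generate G (H \<union> insert x S)"
      unfolding K_def by (rule mono_generate) auto
    then have "K \<union> S \<subseteq> generate G (H \<union> insert x S)" by (auto intro: generate.incl)
    then have "generate G (K \<union> S) \<subseteq> generate G (H \<union> insert x S)"
      using c by (intro generate_subgroup_incl generate_is_subgroup)
    then have gen: "generate G (H \<union> insert x S) = carrier G"
      using S(3) generate_incl[OF c] by simp
    have "card (insert x S) \<le> Suc (card S)" using S(2) by (simp add: card_insert_if)
    then have "(2::nat) ^ card (insert x S) \<le> 2 ^ Suc (card S)" by (intro power_increasing) auto
    then have "card H * 2 ^ card (insert x S) \<le> (card H * 2) * 2 ^ card S"
      by (simp add: mult.assoc)
    also have "\<dots> \<le> card (carrier G)" using 2 S(4)
      by (meson le_trans mult_le_mono1)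
    finally show ?thesis using S(2) c gen by (intro exI[of _ "insert x S"]) auto
  qed
qed

text \<open>The cosets of \<open>\<one>\<close>, \<open>x\<close> and \<open>x \<otimes> x\<close>
  are distinct, so adjoining \<open>x\<close> first at least triples the order. The factor 3 / 2
  gained over plain doubling later contradicts the equality cases.\<close>

lemma (in comm_group) exists_small_complement_generators_order_3:
  assumes fin: "finite (carrier G)" and H: "subgroup H G"
    and x: "x \<in> carrier G" "x \<otimes> x \<notin> H"
  shows "\<exists>S. S \<subseteq> carrier G \<and> finite S \<and> generate G (H \<union> S) = carrier G
             \<and> 3 * card H * 2 ^ card S \<le> 2 * card (carrier G)"
proof -
  have HG: "H \<subseteq> carrier G" using H by (rule subgroup.subset)
  have xH: "x \<notin> H" using x H by (auto simp: subgroup.m_closed)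
  define K where "K = generate G (insert x H)"
  have K: "subgroup K G" unfolding K_def using x HG by (intro generate_is_subgroup) auto
  have KG: "K \<subseteq> carrier G" using K by (rule subgroup.subset)
  have HK: "H \<subseteq> K" "x \<in> K" unfolding K_def by (auto intro: generate.incl)
  have "card H * card {\<one>, x, x \<otimes> x} \<le> card K"
  proof (rule card_subgroup_mult_transversal_le[OF H KG])
    show "finite K" using KG fin finite_subset by blast
    show "{\<one>, x, x \<otimes> x} \<subseteq> carrier G" using x by simp
    show "h \<otimes> y \<in> K" if "h \<in> H" "y \<in> {\<one>, x, x \<otimes> x}" for h y
      using that HK K subgroup.one_closed[OF K] by (auto intro!: subgroup.m_closed)
    have "x \<otimes> x \<otimes> inv x = x" "x \<otimes> inv (x \<otimes> x) = inv x"
      using x by (simp_all add: m_assoc inv_mult flip: m_assoc[of x "inv x" "inv x"])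
    then show "y = z" if "y \<in> {\<one>, x, x \<otimes> x}" "z \<in> {\<one>, x, x \<otimes> x}" "y \<otimes> inv z \<in> H" for y z
      using that x xH subgroup.m_inv_closed[OF H, of "inv x"]
        subgroup.m_inv_closed[OF H, of "inv (x \<otimes> x)"] by auto
  qed
  moreover have "x \<noteq> \<one>" "x \<otimes> x \<noteq> \<one>" "x \<otimes> x \<noteq> x"
    using x xH subgroup.one_closed[OF H] by (metis, metis, metis l_cancel_one' one_closed)
  then have "card {\<one>, x, x \<otimes> x} = 3"
    by (metis card_3_iff)
  ultimately have 3: "card H * 3 \<le> card K" by simp
  obtain S where S: "S \<subseteq> carrier G" "finite S" "generate G (K \<union> S) = carrier G"
       "card K * 2 ^ card S \<le> card (carrier G)"
    using exists_small_complement_generators[OF fin K] by blast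
  have c: "H \<union> insert x S \<subseteq> carrier G" using HG x S by auto
  have "K \<subseteq> generate G (H \<union> insert x S)"
    unfolding K_def by (rule mono_generate) auto
  then have "K \<union> S \<subseteq> generate G (H \<union> insert x S)" by (auto intro: generate.incl)
  then have "generate G (K \<union> S) \<subseteq> generate G (H \<union> insert x S)"
    using c by (intro generate_subgroup_incl generate_is_subgroup)
  then have gen: "generate G (H \<union> insert x S) = carrier G"
    using S(3) generate_incl[OF c] by simp
  have "card (insert x S) \<le> Suc (card S)" using S(2) by (simp add: card_insert_if)
  then have "(2::nat) ^ card (insert x S) \<le> 2 ^ Suc (card S)" by (intro power_increasing) auto
  then have "3 * card H * 2 ^ card (insert x S) \<le> 2 * ((card H * 3) * 2 ^ card S)"
    by (simp add: mult.assoc)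
  also have "\<dots> \<le> 2 * card (carrier G)" using 3 S(4)
    by (meson le_trans mult_le_mono1 mult_le_mono2)
  finally show ?thesis using S(2) c gen by (intro exI[of _ "insert x S"]) auto
qed

section \<open>The rank and the order of a group\<close>

lemma group_rank_le:
  assumes "S \<subseteq> carrier G" "finite S" "generate G S = carrier G"
  shows "group_rank G \<le> card S"
  unfolding group_rank_def using assms by (intro Least_le) blast

lemma (in group) group_rank_le_insert_one:
  assumes S: "S \<subseteq> carrier G" "finite S" "generate G ({\<one>} \<union> S) = carrier G"
  shows "group_rank G \<le> card S"
proof (rule group_rank_le[OF S(1,2)])
  have "generate G ({\<one>} \<union> S) \<subseteq> generate G S"
    using S(1) by (intro generate_subgroup_incl generate_is_subgroup) (auto intro: generate.one generate.incl)
  then show "generate G S = carrier G" using S(3) generate_incl[OF S(1)] by simp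
qed

lemma (in group) group_rank_generators:
  assumes "finite (carrier G)"
  shows "\<exists>S. S \<subseteq> carrier G \<and> finite S \<and> card S = group_rank G \<and> generate G S = carrier G"
  unfolding group_rank_def
proof (rule LeastI_ex, intro exI conjI)
  show "generate G (carrier G) = carrier G"
    using generateI[OF subgroup_self, of "carrier G"] by auto
qed (use assms in auto)

text \<open>An element of order at least 3 could be completed to a generating set with fewer than
  the rank many elements.\<close>

lemma (in comm_group) elementary_abelian_if_card_le:
  assumes fin: "finite (carrier G)" and le: "card (carrier G) \<le> 2 ^ group_rank G"
  shows "elementary_abelian G"
proof -
  define n where "n = group_rank G"
  have sq: "x \<otimes> x = \<one>" if x: "x \<in> carrier G" for x
  proof (rule ccontr)
    assume "x \<otimes> x \<noteq> \<one>"
    then obtain S where S: "S \<subseteq> carrier G" "finite S" "generate G ({\<one>} \<union> S) = carrier G"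
       "3 * card {\<one>} * 2 ^ card S \<le> 2 * card (carrier G)"
      using exists_small_complement_generators_order_3[OF fin triv_subgroup x] by auto
    have "n \<le> card S"
      unfolding n_def by (rule group_rank_le_insert_one[OF S(1-3)])
    then have "(2::nat) ^ n \<le> 2 ^ card S" by (intro power_increasing) auto
    moreover have "3 * (2::nat) ^ card S \<le> 2 * 2 ^ n" using S(4) le unfolding n_def by simp
    ultimately have "3 * (2::nat) ^ n \<le> 2 * 2 ^ n" by linarith
    then show False by simp
  qed
  obtain S where S: "S \<subseteq> carrier G" "finite S" "card S = n" "generate G S = carrier G"
    using group_rank_generators[OF fin] unfolding n_def by blast
  obtain e where e: "bij_betw e {..<n} S"
    using ex_bij_betw_nat_finite[OF S(2)] S(3) atLeast0LessThan by auto
  have eG: "e i \<in> carrier G" if "i < n" for i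
    using e S(1) that by (auto simp: bij_betw_def)
  let ?P = "product_group {..<n} (\<lambda>_. integer_mod_group 2)"
  let ?C = "{..<n} \<rightarrow>\<^sub>E {0..<2::int}"
  \<comment> \<open>All squares being trivial, exponents matter only modulo 2; \<open>f\<close>
    sends a vector of exponents to the product of powers of the generators.\<close>
  define f where "f v = (\<Otimes>i\<in>{..<n}. e i [^] (v i :: int))" for v
  have carr: "carrier ?P = ?C" by (simp add: carrier_integer_mod_group)
  have pow_mod: "a [^] (k mod 2 :: int) = a [^] k" if "a \<in> carrier G" for a k
  proof -
    have "a [^] k = a [^] (2 * (k div 2) + k mod 2)" by simp
    also have "\<dots> = (a [^] (2::int)) [^] (k div 2) \<otimes> a [^] (k mod 2)"
      using that by (metis int_pow_mult int_pow_pow)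
    also have "a [^] (2::int) = \<one>"
      using sq[OF that] that int_pow_mult[OF that, of 1 1] by simp
    finally show ?thesis using that by (simp add: int_pow_one)
  qed
  have "f \<in> hom ?P G"
  proof (rule homI)
    show "f v \<in> carrier G" if "v \<in> carrier ?P" for v
      unfolding f_def using eG by (intro finprod_closed) auto
    show "f (v \<otimes>\<^bsub>?P\<^esub> w) = f v \<otimes> f w" if "v \<in> carrier ?P" "w \<in> carrier ?P" for v w
    proof -
      have "f (v \<otimes>\<^bsub>?P\<^esub> w) = (\<Otimes>i\<in>{..<n}. e i [^] (v i) \<otimes> e i [^] (w i))"
        unfolding f_def using eG by (intro finprod_cong') (auto simp: pow_mod int_pow_mult)
      also have "\<dots> = f v \<otimes> f w"
        unfolding f_def using eG by (intro finprod_multf) auto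
      finally show ?thesis .
    qed
  qed
  then interpret h: group_hom ?P G f
    by (intro group_hom.intro group_hom_axioms.intro product_group) (simp_all add: is_group)
  have "S \<subseteq> f ` carrier ?P"
  proof
    fix s assume "s \<in> S"
    then obtain j where j: "j < n" "s = e j" using e by (auto simp: bij_betw_def)
    define v where "v = (\<lambda>i\<in>{..<n}. if i = j then 1 else 0 :: int)"
    have "f v = (\<Otimes>i\<in>{..<n}. if j = i then e i else \<one>)"
      unfolding f_def v_def using eG by (intro finprod_cong') auto
    also have "\<dots> = s"
      using j eG by (subst finprod_singleton[of j "{..<n}" e]) auto
    finally have "f v = s" .
    moreover have "v \<in> carrier ?P" by (auto simp: carr v_def)
    ultimately show "s \<in> f ` carrier ?P" by blast
  qed
  then have "generate G S \<subseteq> f ` carrier ?P"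
    by (intro generate_subgroup_incl h.img_is_subgroup group.subgroup_self h.G.is_group)
  then have surj: "f ` carrier ?P = carrier G" using S(4) h.hom_closed by auto
  have "finite (carrier ?P)" unfolding carr by (intro finite_PiE) auto
  moreover have "card (carrier ?P) = 2 ^ n" unfolding carr by (simp add: card_PiE)
  \<comment> \<open>Greedily chosen generators bound the order from below. With the assumed upper
    bound, the surjection \<open>f\<close> is between sets of equal size, hence injective.\<close>
  moreover have "2 ^ n \<le> card (carrier G)"
  proof -
    obtain S where S: "S \<subseteq> carrier G" "finite S" "generate G ({\<one>} \<union> S) = carrier G"
       "card {\<one>} * 2 ^ card S \<le> card (carrier G)"
      using exists_small_complement_generators[OF fin triv_subgroup] by auto
    have "n \<le> card S"
      unfolding n_def by (rule group_rank_le_insert_one[OF S(1-3)])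
    then have "(2::nat) ^ n \<le> 2 ^ card S" by (intro power_increasing) auto
    also have "\<dots> \<le> card (carrier G)" using S(4) by simp
    finally show ?thesis .
  qed
  ultimately have "inj_on f (carrier ?P)"
    using le surj card_image_le[of "carrier ?P" f] unfolding n_def
    by (intro eq_card_imp_inj_on) auto
  then have "f \<in> iso ?P G" using \<open>f \<in> hom ?P G\<close> surj by (auto simp: iso_def bij_betw_def)
  then have "?P \<cong> G" by (auto simp: is_iso_def)
  then have "G \<cong> ?P" by (rule group.iso_sym[OF h.G.is_group])
  then show ?thesis unfolding elementary_abelian_def by (meson two_is_prime_nat)
qed

subsection \<open>Eigenvectors of matrices with a scalar power\<close>

lemma mult_mat_vec_lincomb:
  fixes B :: "'a :: comm_semiring_0 mat"
  assumes B: "B \<in> carrier_mat m m" and x: "\<And>t. t \<in> T \<Longrightarrow> x t \<in> carrier_vec m"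
  shows "B *\<^sub>v Matrix.vec m (\<lambda>i. \<Sum>t\<in>T. a t * x t $ i) = Matrix.vec m (\<lambda>i. \<Sum>t\<in>T. a t * (B *\<^sub>v x t) $ i)"
proof (rule eq_vecI)
  fix i assume "i < dim_vec (Matrix.vec m (\<lambda>i. \<Sum>t\<in>T. a t * (B *\<^sub>v x t) $ i))"
  then have i: "i < m" by simp
  have "(B *\<^sub>v Matrix.vec m (\<lambda>i. \<Sum>t\<in>T. a t * x t $ i)) $ i
      = (\<Sum>k<m. \<Sum>t\<in>T. a t * (B $$ (i, k) * x t $ k))"
    using B i by (simp add: scalar_prod_def sum_distrib_left atLeast0LessThan mult.left_commute)
  also have "\<dots> = (\<Sum>t\<in>T. a t * (\<Sum>k<m. B $$ (i, k) * x t $ k))"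
    by (subst sum.swap) (simp add: sum_distrib_left)
  also have "\<dots> = (\<Sum>t\<in>T. a t * (B *\<^sub>v x t) $ i)"
    using B i carrier_vecD[OF x] by (intro sum.cong) (auto simp: scalar_prod_def atLeast0LessThan)
  finally show "(B *\<^sub>v Matrix.vec m (\<lambda>i. \<Sum>t\<in>T. a t * x t $ i)) $ i
      = Matrix.vec m (\<lambda>i. \<Sum>t\<in>T. a t * (B *\<^sub>v x t) $ i) $ i"
    using i by simp
qed (use B in auto)

lemma smult_mat_mult_vec:
  fixes A :: "'a :: comm_semiring_0 mat"
  assumes "A \<in> carrier_mat nr nc" "v \<in> carrier_vec nc"
  shows "(k \<cdot>\<^sub>m A) *\<^sub>v v = k \<cdot>\<^sub>v (A *\<^sub>v v)"
  using assms by (intro eq_vecI) (auto simp: scalar_prod_def sum_distrib_left mult.assoc)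

lemma smult_vec_cancel:
  fixes v :: "complex vec"
  assumes "v \<in> carrier_vec m" "v \<noteq> 0\<^sub>v m" "a \<cdot>\<^sub>v v = b \<cdot>\<^sub>v v"
  shows "a = b"
proof -
  obtain i where i: "i < m" "v $ i \<noteq> 0"
    using assms by (metis carrier_vecD eq_vecI index_zero_vec)
  then show ?thesis using arg_cong[OF assms(3), of "\<lambda>x. x $ i"] assms(1) by simp
qed

text \<open>Some \<open>N\<close>-th root of unity \<open>z\<close> has
  \<open>z ^ t \<noteq> 1\<close>, since \<open>t < N\<close>. Multiplication by \<open>z\<close>
  permutes the roots of \<open>c\<close> but scales the sum by
  \<open>inverse (z ^ t)\<close>.\<close>

lemma sum_inverse_power_roots:
  assumes "0 < t" "t < N" "c \<noteq> 0"
  shows "(\<Sum>w | w ^ N = (c::complex). inverse w ^ t) = 0"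
proof -
  have "\<exists>z::complex. z ^ N = 1 \<and> z ^ t \<noteq> 1"
  proof (rule ccontr)
    assume "\<not> ?thesis"
    then have "card {z::complex. z ^ N = 1} \<le> card {z::complex. z ^ t = 1}"
      using assms by (intro card_mono finite_roots_unity) auto
    then show False using assms by (simp add: card_roots_unity_eq)
  qed
  then obtain z :: complex where z: "z ^ N = 1" "z ^ t \<noteq> 1" by blast
  then have "z \<noteq> 0" using assms by (auto simp: zero_power)
  have "bij_betw ((*) z) {w. w ^ N = c} {w. w ^ N = c}"
    using z \<open>z \<noteq> 0\<close>
    by (intro bij_betwI[of _ _ _ "\<lambda>w. inverse z * w"]) (auto simp: power_mult_distrib power_inverse)
  then have "(\<Sum>w | w ^ N = c. inverse w ^ t) = (\<Sum>w | w ^ N = c. inverse (z * w) ^ t)"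
    by (rule sum.reindex_bij_betw[symmetric])
  also have "\<dots> = inverse (z ^ t) * (\<Sum>w | w ^ N = c. inverse w ^ t)"
    by (simp add: power_mult_distrib power_inverse sum_distrib_left)
  finally have "(1 - inverse (z ^ t)) * (\<Sum>w | w ^ N = c. inverse w ^ t) = 0"
    by (simp add: algebra_simps)
  then show ?thesis using z by auto
qed

text \<open>Up to the factor \<open>N\<close>, this is the projection of \<open>v\<close> to the \<open>w\<close>-eigenspace of \<open>A\<close> if
  \<open>A ^ N\<close> is the scalar \<open>w ^ N\<close>.\<close>

definition eigen_component :: "complex mat \<Rightarrow> nat \<Rightarrow> complex \<Rightarrow> complex vec \<Rightarrow> complex vec" where
  "eigen_component A N w v =
     Matrix.vec (dim_vec v) (\<lambda>i. \<Sum>t<N. inverse w ^ t * (((*\<^sub>v) A ^^ t) v) $ i)"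

lemma iterate_mult_mat_vec_carrier:
  "A \<in> carrier_mat m m \<Longrightarrow> v \<in> carrier_vec m \<Longrightarrow> ((*\<^sub>v) A ^^ t) v \<in> carrier_vec m"
  by (induction t) auto

lemma eigen_component_carrier: "v \<in> carrier_vec m \<Longrightarrow> eigen_component A N w v \<in> carrier_vec m"
  by (simp add: eigen_component_def)

lemma mult_eigen_component:
  assumes A: "A \<in> carrier_mat m m" and v: "v \<in> carrier_vec m"
    and N: "((*\<^sub>v) A ^^ N) v = c \<cdot>\<^sub>v v" and w: "w ^ N = c" "w \<noteq> 0"
  shows "A *\<^sub>v eigen_component A N w v = w \<cdot>\<^sub>v eigen_component A N w v"
proof -
  let ?x = "\<lambda>t. ((*\<^sub>v) A ^^ t) v"
  have dv: "dim_vec v = m" using v by simp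
  show ?thesis
    unfolding eigen_component_def dv mult_mat_vec_lincomb[OF A iterate_mult_mat_vec_carrier[OF A v]]
  proof (rule eq_vecI)
    fix i assume "i < dim_vec (w \<cdot>\<^sub>v Matrix.vec m (\<lambda>i. \<Sum>t<N. inverse w ^ t * ?x t $ i))"
    then have i: "i < m" by simp
    have "(\<Sum>t<N. inverse w ^ t * (A *\<^sub>v ?x t) $ i) = w * (\<Sum>t<N. inverse w ^ Suc t * ?x (Suc t) $ i)"
      using w by (simp add: sum_distrib_left field_simps)
    \<comment> \<open>Shifting the index gains the term for \<open>N\<close> and loses the term for
      0; both equal \<open>v $ i\<close> because \<open>w ^ N = c\<close>.\<close>
    also have "(\<Sum>t<N. inverse w ^ Suc t * ?x (Suc t) $ i)
      = (\<Sum>t<Suc N. inverse w ^ t * ?x t $ i) - v $ i"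
      by (subst sum.lessThan_Suc_shift) simp
    also have "\<dots> = (\<Sum>t<N. inverse w ^ t * ?x t $ i)"
      using N v i w by (auto simp: power_inverse)
    finally show "Matrix.vec m (\<lambda>i. \<Sum>t<N. inverse w ^ t * (A *\<^sub>v ?x t) $ i) $ i
      = (w \<cdot>\<^sub>v Matrix.vec m (\<lambda>i. \<Sum>t<N. inverse w ^ t * ?x t $ i)) $ i"
      using i by simp
  qed simp
qed

text \<open>The iterates of \<open>v\<close> under \<open>A\<close> stay in the
  \<open>b\<close>-eigenspace of \<open>B\<close>. This preserves eigenvalues found earlier when a
  joint eigenvector is refined.\<close>

lemma commuting_mult_eigen_component:
  assumes A: "A \<in> carrier_mat m m" and B: "B \<in> carrier_mat m m" and v: "v \<in> carrier_vec m"
    and AB: "A * B = B * A" and b: "B *\<^sub>v v = b \<cdot>\<^sub>v v"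
  shows "B *\<^sub>v eigen_component A N w v = b \<cdot>\<^sub>v eigen_component A N w v"
proof -
  let ?x = "\<lambda>t. ((*\<^sub>v) A ^^ t) v"
  have x: "?x t \<in> carrier_vec m" for t by (rule iterate_mult_mat_vec_carrier[OF A v])
  have Bx: "B *\<^sub>v ?x t = b \<cdot>\<^sub>v ?x t" for t
  proof (induction t)
    case (Suc t)
    have "B *\<^sub>v (A *\<^sub>v ?x t) = A *\<^sub>v (B *\<^sub>v ?x t)"
      using A B x AB by (metis assoc_mult_mat_vec)
    also have "\<dots> = b \<cdot>\<^sub>v (A *\<^sub>v ?x t)"
      using Suc A x by (simp add: mult_mat_vec)
    finally show ?case by simp
  qed (simp add: b)
  have dv: "dim_vec v = m" using v by simp
  show ?thesis
    unfolding eigen_component_def dv mult_mat_vec_lincomb[OF B x] Bx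
  proof (rule eq_vecI)
    fix i assume "i < dim_vec (b \<cdot>\<^sub>v Matrix.vec m (\<lambda>i. \<Sum>t<N. inverse w ^ t * ?x t $ i))"
    then have "i < m" by simp
    then show "Matrix.vec m (\<lambda>i. \<Sum>t<N. inverse w ^ t * (b \<cdot>\<^sub>v ?x t) $ i) $ i
      = (b \<cdot>\<^sub>v Matrix.vec m (\<lambda>i. \<Sum>t<N. inverse w ^ t * ?x t $ i)) $ i"
      using carrier_vecD[OF x] by (simp add: sum_distrib_left mult.left_commute)
  qed simp
qed

text \<open>Fourier inversion: summing over the roots \<open>w\<close> kills every power except
  \<open>t = 0\<close>, whose coefficient is the number \<open>N\<close> of roots.\<close>

lemma sum_eigen_component:
  fixes A :: "complex mat"
  assumes v: "v \<in> carrier_vec m" and "i < m" "N > 0" "c \<noteq> 0"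
  shows "(\<Sum>w | w ^ N = c. eigen_component A N w v $ i) = of_nat N * v $ i"
proof -
  let ?x = "\<lambda>t. ((*\<^sub>v) A ^^ t) v"
  have "(\<Sum>w | w ^ N = c. eigen_component A N w v $ i)
      = (\<Sum>t<N. (\<Sum>w | w ^ N = c. inverse w ^ t) * ?x t $ i)"
    using assms by (simp add: eigen_component_def sum_distrib_right) (rule sum.swap)
  also have "\<dots> = (\<Sum>t<N. if t = 0 then of_nat N * v $ i else 0)"
    using assms sum_inverse_power_roots[of _ N c] by (intro sum.cong) (auto simp: card_nth_roots)
  also have "\<dots> = of_nat N * v $ i" using \<open>N > 0\<close> by simp
  finally show ?thesis .
qed

text \<open>As \<open>A ^ N\<close> is the nonzero scalar \<open>d\<close>, the components split
  every vector into eigenvectors of \<open>A\<close>; if only the eigenvalue \<open>c\<close>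
  occurs, \<open>A\<close> acts as \<open>c\<close>.\<close>

lemma scalar_mat_if_unique_eigenvalue:
  fixes A :: "complex mat"
  assumes A: "A \<in> carrier_mat m m" and "N > 0" "d \<noteq> 0"
    and pow: "\<And>v. v \<in> carrier_vec m \<Longrightarrow> ((*\<^sub>v) A ^^ N) v = d \<cdot>\<^sub>v v"
    and uniq: "\<And>w v. v \<in> carrier_vec m \<Longrightarrow> v \<noteq> 0\<^sub>v m \<Longrightarrow> A *\<^sub>v v = w \<cdot>\<^sub>v v \<Longrightarrow> w = c"
  shows "A = c \<cdot>\<^sub>m 1\<^sub>m m"
proof -
  have main: "A *\<^sub>v v = c \<cdot>\<^sub>v v" if v: "v \<in> carrier_vec m" for v
  proof -
    let ?u = "\<lambda>w. eigen_component A N w v"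
    let ?R = "{w. w ^ N = d}"
    have u: "?u w \<in> carrier_vec m" for w using v by (rule eigen_component_carrier)
    have Au: "A *\<^sub>v ?u w = c \<cdot>\<^sub>v ?u w" if "w \<in> ?R" for w
    proof (cases "?u w = 0\<^sub>v m")
      case True
      then show ?thesis using A by (intro eq_vecI) auto
    next
      case False
      have "w \<noteq> 0" using that assms(2,3) by (auto simp: zero_power)
      then have "A *\<^sub>v ?u w = w \<cdot>\<^sub>v ?u w"
        using that by (intro mult_eigen_component[OF A v pow[OF v]]) auto
      then show ?thesis using uniq[OF u False] by metis
    qed
    have v_eq: "v = Matrix.vec m (\<lambda>i. \<Sum>w\<in>?R. 1 / of_nat N * ?u w $ i)"
      using v assms(2,3) by (intro eq_vecI) (auto simp: sum_eigen_component simp flip: sum_divide_distrib)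
    have "A *\<^sub>v v = Matrix.vec m (\<lambda>i. \<Sum>w\<in>?R. 1 / of_nat N * (A *\<^sub>v ?u w) $ i)"
      by (subst v_eq, rule mult_mat_vec_lincomb[OF A u])
    also have "\<dots> = Matrix.vec m (\<lambda>i. c * (\<Sum>w\<in>?R. 1 / of_nat N * ?u w $ i))"
      using carrier_vecD[OF u] by (intro eq_vecI) (auto simp: Au sum_distrib_left intro!: sum.cong)
    also have "\<dots> = c \<cdot>\<^sub>v Matrix.vec m (\<lambda>i. \<Sum>w\<in>?R. 1 / of_nat N * ?u w $ i)"
      by (intro eq_vecI) auto
    also have "\<dots> = c \<cdot>\<^sub>v v" by (simp only: v_eq[symmetric])
    finally show ?thesis .
  qed
  show ?thesis
  proof (rule eq_matI)
    fix i j assume "i < dim_row (c \<cdot>\<^sub>m 1\<^sub>m m)" "j < dim_col (c \<cdot>\<^sub>m 1\<^sub>m m)"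
    then have ij: "i < m" "j < m" by auto
    then have "A $$ (i, j) = (A *\<^sub>v unit_vec m j) $ i"
      using A by (simp add: scalar_prod_right_unit)
    also have "\<dots> = (c \<cdot>\<^sub>m 1\<^sub>m m) $$ (i, j)"
      using main[of "unit_vec m j"] ij by simp
    finally show "A $$ (i, j) = (c \<cdot>\<^sub>m 1\<^sub>m m) $$ (i, j)" .
  qed (use A in auto)
qed

subsection \<open>The commutator form and maximal isotropic subgroups\<close>

locale comm_proj_rep = comm_group G for G (structure) +
  fixes m :: nat and \<alpha> :: "'a \<Rightarrow> 'a \<Rightarrow> complex" and \<rho> :: "'a \<Rightarrow> complex mat"
  assumes finite_carrier: "finite (carrier G)"
    and proj_rep: "proj_rep G m \<alpha> \<rho>"
begin

text \<open>On an abelian group this is an alternating bicharacter, the scalar by which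
  \<open>\<rho> g * \<rho> h\<close> and \<open>\<rho> h * \<rho> g\<close> differ.\<close>

definition commutator_form :: "'a \<Rightarrow> 'a \<Rightarrow> complex" where
  "commutator_form g h = \<alpha> g h / \<alpha> h g"

lemma
  shows alpha_nonzero: "g \<in> carrier G \<Longrightarrow> h \<in> carrier G \<Longrightarrow> \<alpha> g h \<noteq> 0"
    and cocycle: "g \<in> carrier G \<Longrightarrow> h \<in> carrier G \<Longrightarrow> k \<in> carrier G \<Longrightarrow>
      \<alpha> g h * \<alpha> (g \<otimes> h) k = \<alpha> h k * \<alpha> g (h \<otimes> k)"
    and rho_carrier: "g \<in> carrier G \<Longrightarrow> \<rho> g \<in> carrier_mat m m"
    and rho_invertible: "g \<in> carrier G \<Longrightarrow> invertible_mat (\<rho> g)"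
    and rho_one: "\<rho> \<one> = 1\<^sub>m m"
    and rho_mult: "g \<in> carrier G \<Longrightarrow> h \<in> carrier G \<Longrightarrow> \<rho> g * \<rho> h = \<alpha> g h \<cdot>\<^sub>m \<rho> (g \<otimes> h)"
  using proj_rep unfolding proj_rep_def by auto

lemma commutator_form_nonzero:
  "g \<in> carrier G \<Longrightarrow> h \<in> carrier G \<Longrightarrow> commutator_form g h \<noteq> 0"
  by (simp add: commutator_form_def alpha_nonzero)

lemma commutator_form_swap: "commutator_form h g = inverse (commutator_form g h)"
  by (simp add: commutator_form_def)

lemma commutator_form_self: "g \<in> carrier G \<Longrightarrow> commutator_form g g = 1"
  by (simp add: commutator_form_def alpha_nonzero)

text \<open>Three instances of the cocycle identity, with arguments reordered by commutativity, are
  combined, and the nonzero factor \<open>\<alpha> g h\<close> cancels.\<close>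

lemma commutator_form_mult_left:
  assumes [simp]: "g \<in> carrier G" "h \<in> carrier G" "k \<in> carrier G"
  shows "commutator_form (g \<otimes> h) k = commutator_form g k * commutator_form h k"
proof -
  have 1: "\<alpha> g h * \<alpha> (g \<otimes> h) k = \<alpha> h k * \<alpha> g (h \<otimes> k)" by (rule cocycle) simp_all
  have 2: "\<alpha> k g * \<alpha> (g \<otimes> k) h = \<alpha> g h * \<alpha> k (g \<otimes> h)"
    using cocycle[of k g h] by (simp add: m_comm)
  have 3: "\<alpha> g k * \<alpha> (g \<otimes> k) h = \<alpha> k h * \<alpha> g (h \<otimes> k)"
    using cocycle[of g k h] by (simp add: m_comm)
  have "\<alpha> g h * (\<alpha> (g \<otimes> h) k * (\<alpha> k g * \<alpha> k h)) = \<alpha> h k * \<alpha> k g * (\<alpha> k h * \<alpha> g (h \<otimes> k))"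
    using 1 by (simp add: algebra_simps)
  also have "\<dots> = \<alpha> h k * \<alpha> g k * (\<alpha> k g * \<alpha> (g \<otimes> k) h)"
    using 3 by (simp add: algebra_simps)
  also have "\<dots> = \<alpha> g h * (\<alpha> k (g \<otimes> h) * (\<alpha> g k * \<alpha> h k))"
    using 2 by (simp add: algebra_simps)
  finally have "\<alpha> (g \<otimes> h) k * (\<alpha> k g * \<alpha> k h) = \<alpha> k (g \<otimes> h) * (\<alpha> g k * \<alpha> h k)"
    using alpha_nonzero[of g h] by simp
  then show ?thesis
    by (simp add: commutator_form_def alpha_nonzero field_simps)
qed

lemma commutator_form_mult_right:
  assumes "g \<in> carrier G" "h \<in> carrier G" "k \<in> carrier G"
  shows "commutator_form g (h \<otimes> k) = commutator_form g h * commutator_form g k"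
  using commutator_form_mult_left[OF assms(2,3,1)] commutator_form_swap[of g]
  by (metis inverse_mult_distrib)

lemma commutator_form_char: "g \<in> carrier G \<Longrightarrow> complex_char_on G (carrier G) (\<lambda>h. commutator_form h g)"
  by (simp add: complex_char_on_def commutator_form_nonzero commutator_form_mult_left)

lemma rho_swap:
  assumes "g \<in> carrier G" "h \<in> carrier G"
  shows "\<rho> g * \<rho> h = commutator_form g h \<cdot>\<^sub>m (\<rho> h * \<rho> g)"
proof -
  have "commutator_form g h \<cdot>\<^sub>m (\<rho> h * \<rho> g) = (commutator_form g h * \<alpha> h g) \<cdot>\<^sub>m \<rho> (h \<otimes> g)"
    unfolding rho_mult[OF assms(2,1)] by (intro eq_matI) auto
  also have "\<dots> = \<rho> g * \<rho> h"
    using assms by (simp add: commutator_form_def alpha_nonzero rho_mult m_comm)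
  finally show ?thesis ..
qed

lemma rho_mult_vec_nonzero:
  assumes g: "g \<in> carrier G" and v: "v \<in> carrier_vec m" "v \<noteq> 0\<^sub>v m"
  shows "\<rho> g *\<^sub>v v \<noteq> 0\<^sub>v m"
proof
  assume 0: "\<rho> g *\<^sub>v v = 0\<^sub>v m"
  obtain B where B: "B * \<rho> g = 1\<^sub>m (dim_row B)" "\<rho> g * B = 1\<^sub>m m"
    using rho_invertible[OF g] rho_carrier[OF g] by (auto simp: invertible_mat_def inverts_mat_def)
  have Bc: "B \<in> carrier_mat m m"
    using arg_cong[OF B(1), of dim_col] arg_cong[OF B(2), of dim_col] rho_carrier[OF g] by auto
  have "v = (B * \<rho> g) *\<^sub>v v" using B Bc v by simp
  also have "\<dots> = B *\<^sub>v (\<rho> g *\<^sub>v v)" using Bc rho_carrier[OF g] v by (intro assoc_mult_mat_vec)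
  also have "\<dots> = 0\<^sub>v m" unfolding 0 using Bc by (intro eq_vecI) auto
  finally show False using v by simp
qed

text \<open>Stated for iterated application to vectors, rather than matrix powers, to match
  \<open>eigen_component\<close>.\<close>

lemma iterate_rho:
  assumes g: "g \<in> carrier G"
  shows "\<exists>c. c \<noteq> 0 \<and> (\<forall>v\<in>carrier_vec m. ((*\<^sub>v) (\<rho> g) ^^ t) v = c \<cdot>\<^sub>v (\<rho> (g [^] t) *\<^sub>v v))"
proof (induction t)
  case 0
  then show ?case by (intro exI[of _ 1]) (simp add: rho_one)
next
  case (Suc t)
  then obtain c where c: "c \<noteq> 0"
    "\<And>v. v \<in> carrier_vec m \<Longrightarrow> ((*\<^sub>v) (\<rho> g) ^^ t) v = c \<cdot>\<^sub>v (\<rho> (g [^] t) *\<^sub>v v)" by blast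
  have gt: "g [^] t \<in> carrier G" using g by simp
  have "((*\<^sub>v) (\<rho> g) ^^ Suc t) v = (c * \<alpha> g (g [^] t)) \<cdot>\<^sub>v (\<rho> (g [^] Suc t) *\<^sub>v v)"
    if v: "v \<in> carrier_vec m" for v
  proof -
    have "((*\<^sub>v) (\<rho> g) ^^ Suc t) v = c \<cdot>\<^sub>v (\<rho> g *\<^sub>v (\<rho> (g [^] t) *\<^sub>v v))"
      using c(2)[OF v] rho_carrier[OF g] rho_carrier[OF gt] v
      by (simp add: mult_mat_vec)
    also have "\<rho> g *\<^sub>v (\<rho> (g [^] t) *\<^sub>v v) = (\<rho> g * \<rho> (g [^] t)) *\<^sub>v v"
      using rho_carrier[OF g] rho_carrier[OF gt] v by simp
    also have "\<dots> = \<alpha> g (g [^] t) \<cdot>\<^sub>v (\<rho> (g [^] Suc t) *\<^sub>v v)"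
      using g gt v rho_carrier[of "g [^] t \<otimes> g"]
      by (intro eq_vecI) (auto simp: rho_mult m_comm)
    finally show ?thesis by (simp add: smult_smult_assoc)
  qed
  then show ?case using c(1) alpha_nonzero[OF g gt] by (intro exI[of _ "c * \<alpha> g (g [^] t)"]) auto
qed

text \<open>Since \<open>g\<close> to the power of the group order is \<open>\<one>\<close>, a power
  of \<open>\<rho> g\<close> is a nonzero scalar, so \<open>\<rho> g\<close> admits the splitting
  into eigenspace components.\<close>

lemma iterate_rho_order:
  assumes g: "g \<in> carrier G"
  shows "\<exists>c. c \<noteq> 0 \<and> (\<forall>v\<in>carrier_vec m. ((*\<^sub>v) (\<rho> g) ^^ Coset.order G) v = c \<cdot>\<^sub>v v)"
  using iterate_rho[OF g, of "Coset.order G"] pow_order_eq_1[OF g] by (auto simp: rho_one)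

lemma order_pos: "Coset.order G > 0"
  using finite_carrier by (auto simp: Coset.order_def card_gt_0_iff)

text \<open>A set maximal under inclusion suffices: an element orthogonal to \<open>L\<close> can be
  added, since the form is alternating, and so lies in \<open>L\<close> already.\<close>

lemma exists_maximal_isotropic:
  "\<exists>L. L \<subseteq> carrier G \<and> (\<forall>g\<in>L. \<forall>h\<in>L. commutator_form g h = 1)
     \<and> (\<forall>x\<in>carrier G. (\<forall>g\<in>L. commutator_form g x = 1) \<longrightarrow> x \<in> L)"
proof -
  define A where "A = {L. L \<subseteq> carrier G \<and> (\<forall>g\<in>L. \<forall>h\<in>L. commutator_form g h = 1)}"
  have "finite A" "A \<noteq> {}" using finite_carrier by (auto simp: A_def)
  then obtain L where L: "L \<in> A" "\<And>M. M \<in> A \<Longrightarrow> L \<subseteq> M \<Longrightarrow> L = M"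
    using finite_has_maximal[of A] by blast
  have "x \<in> L" if x: "x \<in> carrier G" "\<forall>g\<in>L. commutator_form g x = 1" for x
  proof -
    have "commutator_form x g = 1" if "g \<in> L" for g
      using x that commutator_form_swap[of x g] by simp
    then have "insert x L \<in> A" using L(1) x by (auto simp: A_def commutator_form_self)
    then show ?thesis using L(2)[of "insert x L"] by blast
  qed
  then show ?thesis using L(1) unfolding A_def by blast
qed

end

text \<open>The assumptions make \<open>L\<close> its own orthogonal complement for the commutator
  form; that \<open>L\<close> is a subgroup is a consequence.\<close>

locale lagrangian_proj_rep = comm_proj_rep +
  fixes L
  assumes L_subset: "L \<subseteq> carrier G"
    and isotropic: "g \<in> L \<Longrightarrow> h \<in> L \<Longrightarrow> commutator_form g h = 1"
    and maximal: "x \<in> carrier G \<Longrightarrow> (\<And>g. g \<in> L \<Longrightarrow> commutator_form g x = 1) \<Longrightarrow> x \<in> L"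
begin

lemma L_carrier: "g \<in> L \<Longrightarrow> g \<in> carrier G"
  using L_subset by blast

lemma L_iff: "x \<in> L \<longleftrightarrow> x \<in> carrier G \<and> (\<forall>g\<in>L. commutator_form x g = 1)"
  using isotropic maximal L_carrier commutator_form_swap by (metis inverse_1)

lemma finite_L: "finite L"
  using L_subset finite_carrier finite_subset by blast

lemma subgroup_L: "subgroup L G"
proof (rule subgroupI)
  have ch: "commutator_form (inv x) g = inverse (commutator_form x g)"
    if "x \<in> carrier G" "g \<in> carrier G" for x g
    using complex_char_on_inv[OF commutator_form_char subgroup_self] that by blast
  show "inv x \<in> L" if "x \<in> L" for x
    using that ch L_carrier by (simp add: L_iff[of x] L_iff[of "inv x"])
  show "x \<otimes> y \<in> L" if "x \<in> L" "y \<in> L" for x y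
    using that L_carrier by (simp add: L_iff[of x] L_iff[of y] L_iff[of "x \<otimes> y"] commutator_form_mult_left)
  have "\<one> \<in> L"
    using complex_char_on_one[OF commutator_form_char subgroup_self] L_carrier by (simp add: L_iff[of \<one>])
  then show "L \<noteq> {}" by blast
qed (rule L_subset)

section \<open>Joint eigenvalue functions on \<open>L\<close>\<close>

lemma rho_commute: "g \<in> L \<Longrightarrow> h \<in> L \<Longrightarrow> \<rho> g * \<rho> h = \<rho> h * \<rho> g"
  by (subst rho_swap) (auto simp: isotropic L_carrier intro!: eq_matI)

text \<open>Extensionality makes functions that agree on \<open>L\<close> equal, so that they can be
  counted. Such a function is multiplicative only up to the cocycle.\<close>

definition eigenchar :: "('a \<Rightarrow> complex) \<Rightarrow> bool" where
  "eigenchar \<xi> \<longleftrightarrow> \<xi> \<in> extensional L \<and>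
     (\<exists>v\<in>carrier_vec m. v \<noteq> 0\<^sub>v m \<and> (\<forall>g\<in>L. \<rho> g *\<^sub>v v = \<xi> g \<cdot>\<^sub>v v))"

text \<open>The eigenvector is refined one element \<open>h\<close> at a time, being replaced by one
  of its components for \<open>\<rho> h\<close>. Commutativity on \<open>L\<close> preserves the
  earlier eigenvalues, in particular \<open>c\<close> at \<open>g\<close>.\<close>

lemma joint_eigenvector:
  assumes g: "g \<in> L" and v: "v \<in> carrier_vec m" "v \<noteq> 0\<^sub>v m" "\<rho> g *\<^sub>v v = c \<cdot>\<^sub>v v"
    and "finite F" "F \<subseteq> L"
  shows "\<exists>u\<in>carrier_vec m. u \<noteq> 0\<^sub>v m \<and> (\<exists>\<xi>. \<xi> g = c \<and> (\<forall>h\<in>insert g F. \<rho> h *\<^sub>v u = \<xi> h \<cdot>\<^sub>v u))"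
  using assms(5,6)
proof (induction F rule: finite_induct)
  case empty
  then show ?case using v by (intro bexI[of _ v] conjI exI[of _ "\<lambda>_. c"]) auto
next
  case (insert h F)
  then obtain u \<xi> where u: "u \<in> carrier_vec m" "u \<noteq> 0\<^sub>v m" "\<xi> g = c"
    "\<And>k. k \<in> insert g F \<Longrightarrow> \<rho> k *\<^sub>v u = \<xi> k \<cdot>\<^sub>v u" by blast
  show ?case
  proof (cases "h = g")
    case True
    then show ?thesis using u by (intro bexI[of _ u] conjI exI[of _ \<xi>]) auto
  next
    case False
    have h: "h \<in> L" using insert by simp
    let ?N = "Coset.order G"
    obtain d where d: "d \<noteq> 0" "((*\<^sub>v) (\<rho> h) ^^ ?N) u = d \<cdot>\<^sub>v u"
      using iterate_rho_order[OF L_carrier[OF h]] u(1) by blast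
    obtain i where i: "i < m" "u $ i \<noteq> 0"
      using u(1,2) by (metis carrier_vecD eq_vecI index_zero_vec)
    \<comment> \<open>The components add up to a nonzero multiple of \<open>u\<close>, so one of
      them is nonzero at the index \<open>i\<close>.\<close>
    have "(\<Sum>w | w ^ ?N = d. eigen_component (\<rho> h) ?N w u $ i) \<noteq> 0"
      using sum_eigen_component[OF u(1) i(1) order_pos d(1)] i order_pos by simp
    then obtain w where w: "w ^ ?N = d" "eigen_component (\<rho> h) ?N w u $ i \<noteq> 0"
      by (auto elim: sum.not_neutral_contains_not_neutral)
    let ?u = "eigen_component (\<rho> h) ?N w u"
    have "w \<noteq> 0" using w d order_pos by (auto simp: zero_power)
    then have hu: "\<rho> h *\<^sub>v ?u = w \<cdot>\<^sub>v ?u"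
      using mult_eigen_component[OF rho_carrier[OF L_carrier[OF h]] u(1) d(2) w(1)] by blast
    have ku: "\<rho> k *\<^sub>v ?u = \<xi> k \<cdot>\<^sub>v ?u" if "k \<in> insert g F" for k
    proof -
      have k: "k \<in> L" using that g insert by auto
      show ?thesis
        by (intro commuting_mult_eigen_component[of _ m] rho_carrier L_carrier h k u rho_commute that)
    qed
    show ?thesis
    proof (intro bexI[of _ ?u] conjI exI[of _ "\<xi>(h := w)"] ballI)
      show "?u \<noteq> 0\<^sub>v m" using w(2) i(1) by auto
      show "\<rho> k *\<^sub>v ?u = (\<xi>(h := w)) k \<cdot>\<^sub>v ?u" if "k \<in> insert g (insert h F)" for k
        using that hu ku by auto
    qed (use False u eigen_component_carrier in auto)
  qed
qed

lemma exists_eigenchar: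
  assumes g: "g \<in> L" and v: "v \<in> carrier_vec m" "v \<noteq> 0\<^sub>v m" "\<rho> g *\<^sub>v v = c \<cdot>\<^sub>v v"
  shows "\<exists>\<xi>. eigenchar \<xi> \<and> \<xi> g = c"
proof -
  obtain u \<xi> where u: "u \<in> carrier_vec m" "u \<noteq> 0\<^sub>v m" "\<xi> g = c"
    "\<And>h. h \<in> insert g L \<Longrightarrow> \<rho> h *\<^sub>v u = \<xi> h \<cdot>\<^sub>v u"
    using joint_eigenvector[OF assms finite_L] by blast
  then show ?thesis
    using g unfolding eigenchar_def
    by (intro exI[of _ "restrict \<xi> L"] conjI bexI[of _ u]) auto
qed

text \<open>Each eigenvalue of \<open>\<rho> g\<close> is the value at \<open>g\<close> of some
  eigenvalue function, so agreement leaves a single eigenvalue; the matrix is diagonalisable, hence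
  scalar.\<close>

lemma scalar_if_eigenchars_agree:
  assumes g: "g \<in> L" and agree: "\<And>\<xi> \<mu>. eigenchar \<xi> \<Longrightarrow> eigenchar \<mu> \<Longrightarrow> \<xi> g = \<mu> g"
  shows "\<exists>c. \<rho> g = c \<cdot>\<^sub>m 1\<^sub>m m"
proof -
  obtain d where d: "d \<noteq> 0" "\<And>v. v \<in> carrier_vec m \<Longrightarrow> ((*\<^sub>v) (\<rho> g) ^^ Coset.order G) v = d \<cdot>\<^sub>v v"
    using iterate_rho_order[OF L_carrier[OF g]] by blast
  \<comment> \<open>Any eigenvalue function serves. If there were none, \<open>\<rho> g\<close>
    would have no eigenvector and the uniqueness shown next would be vacuous.\<close>
  define c where "c = (SOME \<xi>. eigenchar \<xi>) g"
  have "w = c" if v: "v \<in> carrier_vec m" "v \<noteq> 0\<^sub>v m" "\<rho> g *\<^sub>v v = w \<cdot>\<^sub>v v" for w v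
  proof -
    obtain \<xi> where "eigenchar \<xi>" "\<xi> g = w" using exists_eigenchar[OF g v] by blast
    then show ?thesis using agree someI[of eigenchar \<xi>] unfolding c_def by metis
  qed
  then have "\<rho> g = c \<cdot>\<^sub>m 1\<^sub>m m"
    using scalar_mat_if_unique_eigenvalue[OF rho_carrier[OF L_carrier[OF g]] order_pos d] by blast
  then show ?thesis ..
qed

lemma eigenchar_nonzero:
  assumes "eigenchar \<xi>" "g \<in> L"
  shows "\<xi> g \<noteq> 0"
proof
  assume 0: "\<xi> g = 0"
  obtain v where v: "v \<in> carrier_vec m" "v \<noteq> 0\<^sub>v m" "\<rho> g *\<^sub>v v = \<xi> g \<cdot>\<^sub>v v"
    using assms unfolding eigenchar_def by blast
  have "\<rho> g *\<^sub>v v = 0\<^sub>v m" unfolding v(3) 0 using v(1) by (intro eq_vecI) auto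
  then show False using rho_mult_vec_nonzero[OF L_carrier[OF assms(2)] v(1,2)] by simp
qed

lemma eigenchar_mult:
  assumes "eigenchar \<xi>" and g: "g \<in> L" and h: "h \<in> L"
  shows "\<xi> g * \<xi> h = \<alpha> g h * \<xi> (g \<otimes> h)"
proof -
  obtain v where v: "v \<in> carrier_vec m" "v \<noteq> 0\<^sub>v m" "\<And>g. g \<in> L \<Longrightarrow> \<rho> g *\<^sub>v v = \<xi> g \<cdot>\<^sub>v v"
    using assms unfolding eigenchar_def by blast
  have gh: "g \<otimes> h \<in> L" using g h subgroup_L by (simp add: subgroup.m_closed)
  have c: "\<rho> g \<in> carrier_mat m m" "\<rho> h \<in> carrier_mat m m" "\<rho> (g \<otimes> h) \<in> carrier_mat m m"
    using rho_carrier L_carrier g h gh by auto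
  have "(\<xi> g * \<xi> h) \<cdot>\<^sub>v v = \<rho> g *\<^sub>v (\<rho> h *\<^sub>v v)"
    using v g h c by (simp add: mult_mat_vec smult_smult_assoc mult.commute)
  also have "\<dots> = (\<rho> g * \<rho> h) *\<^sub>v v" using c v by simp
  also have "\<dots> = \<alpha> g h \<cdot>\<^sub>v (\<rho> (g \<otimes> h) *\<^sub>v v)"
    unfolding rho_mult[OF L_carrier[OF g] L_carrier[OF h]] using c v by (intro eq_vecI) auto
  also have "\<dots> = (\<alpha> g h * \<xi> (g \<otimes> h)) \<cdot>\<^sub>v v" using v gh by (simp add: smult_smult_assoc)
  finally show ?thesis using smult_vec_cancel[OF v(1,2)] by blast
qed

text \<open>Both functions are multiplicative up to the same cocycle, which cancels in the
  quotient.\<close>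

lemma eigenchar_quotient_char:
  assumes "eigenchar \<xi>" "eigenchar \<mu>"
  shows "complex_char_on G L (\<lambda>g. \<mu> g / \<xi> g)"
  unfolding complex_char_on_def
proof (intro conjI ballI)
  fix g h assume gh: "g \<in> L" "h \<in> L"
  have "\<mu> (g \<otimes> h) / \<xi> (g \<otimes> h) = (\<alpha> g h * \<mu> (g \<otimes> h)) / (\<alpha> g h * \<xi> (g \<otimes> h))"
    using gh L_carrier alpha_nonzero by simp
  also have "\<dots> = (\<mu> g / \<xi> g) * (\<mu> h / \<xi> h)"
    using gh assms by (simp flip: eigenchar_mult)
  finally show "\<mu> (g \<otimes> h) / \<xi> (g \<otimes> h) = (\<mu> g / \<xi> g) * (\<mu> h / \<xi> h)" .
qed (use assms eigenchar_nonzero in auto)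

lemma sum_nontrivial_char:
  assumes chi: "complex_char_on G L \<chi>" and h: "h \<in> L" "\<chi> h \<noteq> 1"
  shows "(\<Sum>g\<in>L. \<chi> g) = 0"
proof -
  have "bij_betw (\<lambda>g. h \<otimes> g) L L"
    using h L_carrier subgroup_L
    by (intro bij_betwI[of _ _ _ "\<lambda>g. inv h \<otimes> g"])
       (auto simp: subgroup.m_closed subgroup.m_inv_closed simp flip: m_assoc)
  then have "(\<Sum>g\<in>L. \<chi> g) = (\<Sum>g\<in>L. \<chi> (h \<otimes> g))"
    by (rule sum.reindex_bij_betw[symmetric])
  also have "\<dots> = \<chi> h * (\<Sum>g\<in>L. \<chi> g)"
    using chi h by (simp add: complex_char_on_def sum_distrib_left)
  finally have "(1 - \<chi> h) * (\<Sum>g\<in>L. \<chi> g) = 0" by (simp add: algebra_simps)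
  then show ?thesis using h by simp
qed

lemma eigenchar_orthogonality:
  assumes "eigenchar \<xi>" "eigenchar \<mu>"
  shows "(\<Sum>g\<in>L. \<mu> g / \<xi> g) = (if \<xi> = \<mu> then of_nat (card L) else 0)"
proof (cases "\<xi> = \<mu>")
  case True
  then have "(\<Sum>g\<in>L. \<mu> g / \<xi> g) = (\<Sum>g\<in>L. 1)"
    using assms eigenchar_nonzero by (intro sum.cong) auto
  then show ?thesis using True by simp
next
  case False
  have "\<exists>h\<in>L. \<xi> h \<noteq> \<mu> h"
    using False assms unfolding eigenchar_def by (meson extensionalityI)
  then obtain h where "h \<in> L" "\<mu> h / \<xi> h \<noteq> 1"
    using eigenchar_nonzero[OF assms(1)] by (metis divide_eq_1_iff)
  then show ?thesis
    using sum_nontrivial_char[OF eigenchar_quotient_char[OF assms]] False by simp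
qed

text \<open>A linear combination of the spectral projections with distinct coefficients has
  all these coefficients as eigenvalues.\<close>

lemma card_eigenchars_le:
  assumes fin: "finite C" and C: "\<And>\<xi>. \<xi> \<in> C \<Longrightarrow> eigenchar \<xi>"
  shows "card C \<le> m"
proof -
  obtain c :: "('a \<Rightarrow> complex) \<Rightarrow> nat" where c: "inj_on c C"
    using finite_imp_inj_to_nat_seg[OF fin] by blast
  \<comment> \<open>The projection for \<open>\<xi>\<close> is the average over \<open>L\<close> of
    the matrices \<open>\<rho> g\<close> divided by \<open>\<xi> g\<close>; it is weighted by the
    label \<open>c \<xi>\<close>.\<close>
  define a where "a g = (\<Sum>\<xi>\<in>C. of_nat (c \<xi>) / (of_nat (card L) * \<xi> g))" for g
  have cardL: "card L \<noteq> 0" using finite_L subgroup.one_closed[OF subgroup_L] by auto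
  define A where "A = Matrix.mat m m (\<lambda>(i, j). \<Sum>g\<in>L. a g * \<rho> g $$ (i, j))"
  have A: "A \<in> carrier_mat m m" by (simp add: A_def)
  have "of_nat (c \<mu>) \<in> spectrum A" if mu: "\<mu> \<in> C" for \<mu>
  proof -
    obtain v where v: "v \<in> carrier_vec m" "v \<noteq> 0\<^sub>v m" "\<And>g. g \<in> L \<Longrightarrow> \<rho> g *\<^sub>v v = \<mu> g \<cdot>\<^sub>v v"
      using C[OF mu] unfolding eigenchar_def by blast
    have "(\<Sum>g\<in>L. a g * \<mu> g) = (\<Sum>\<xi>\<in>C. \<Sum>g\<in>L. of_nat (c \<xi>) / of_nat (card L) * (\<mu> g / \<xi> g))"
      unfolding a_def sum_distrib_right by (subst sum.swap) (simp add: mult.commute)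
    also have "\<dots> = (\<Sum>\<xi>\<in>C. of_nat (c \<xi>) / of_nat (card L) * (\<Sum>g\<in>L. \<mu> g / \<xi> g))"
      by (simp add: sum_distrib_left)
    also have "\<dots> = (\<Sum>\<xi>\<in>C. if \<xi> = \<mu> then of_nat (c \<xi>) else 0)"
      using cardL C mu by (intro sum.cong) (auto simp: eigenchar_orthogonality)
    also have "\<dots> = of_nat (c \<mu>)" using fin mu by simp
    finally have coeff: "(\<Sum>g\<in>L. a g * \<mu> g) = of_nat (c \<mu>)" .
    have "A *\<^sub>v v = of_nat (c \<mu>) \<cdot>\<^sub>v v"
    proof (rule eq_vecI)
      fix i assume "i < dim_vec (of_nat (c \<mu>) \<cdot>\<^sub>v v)"
      then have i: "i < m" using v(1) by simp
      have "(A *\<^sub>v v) $ i = (\<Sum>j<m. \<Sum>g\<in>L. a g * (\<rho> g $$ (i, j) * v $ j))"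
        using i v(1) by (simp add: A_def scalar_prod_def atLeast0LessThan sum_distrib_right mult.assoc)
      also have "\<dots> = (\<Sum>g\<in>L. a g * (\<Sum>j<m. \<rho> g $$ (i, j) * v $ j))"
        by (subst sum.swap) (simp add: sum_distrib_left)
      also have "\<dots> = (\<Sum>g\<in>L. a g * (\<rho> g *\<^sub>v v) $ i)"
      proof (rule sum.cong)
        fix g assume "g \<in> L"
        then show "a g * (\<Sum>j<m. \<rho> g $$ (i, j) * v $ j) = a g * (\<rho> g *\<^sub>v v) $ i"
          using rho_carrier[OF L_carrier, of g] i v(1) by (auto simp: scalar_prod_def atLeast0LessThan)
      qed simp
      also have "\<dots> = (\<Sum>g\<in>L. a g * \<mu> g * v $ i)"
        using v i by (intro sum.cong) auto
      also have "\<dots> = (of_nat (c \<mu>) \<cdot>\<^sub>v v) $ i"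
        using v(1) i by (simp add: coeff flip: sum_distrib_right)
      finally show "(A *\<^sub>v v) $ i = (of_nat (c \<mu>) \<cdot>\<^sub>v v) $ i" .
    qed (use v(1) A in auto)
    then show ?thesis
      using v A by (auto simp: spectrum_def eigenvalue_def eigenvector_def intro!: exI[of _ v])
  qed
  then have "(of_nat \<circ> c) ` C \<subseteq> spectrum A" by auto
  then have le: "card ((of_nat \<circ> c :: _ \<Rightarrow> complex) ` C) \<le> m"
    using card_finite_spectrum[OF A] by (meson card_mono le_trans)
  have "inj_on (of_nat \<circ> c :: _ \<Rightarrow> complex) C"
    using c by (auto simp: inj_on_def)
  then show ?thesis using le by (simp only: card_image)
qed

lemma finite_eigenchars: "finite {\<xi>. eigenchar \<xi>}"
proof (rule ccontr)
  assume "infinite {\<xi>. eigenchar \<xi>}"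
  then obtain C where "C \<subseteq> {\<xi>. eigenchar \<xi>}" "finite C" "card C = Suc m"
    using infinite_arbitrarily_large by blast
  then show False using card_eigenchars_le[of C] by auto
qed

end

subsection \<open>The lower bound\<close>

context lagrangian_proj_rep
begin

text \<open>If \<open>v\<close> has the joint eigenvalues \<open>\<xi>\<close>, these are the joint
  eigenvalues of \<open>\<rho> x *\<^sub>v v\<close>. This is the action of \<open>G\<close> on
  eigenvalue functions.\<close>

definition translate :: "'a \<Rightarrow> ('a \<Rightarrow> complex) \<Rightarrow> 'a \<Rightarrow> complex" where
  "translate x \<xi> = (\<lambda>g\<in>L. commutator_form g x * \<xi> g)"

lemma eigenchar_translate:
  assumes x: "x \<in> carrier G" and xi: "eigenchar \<xi>"
  shows "eigenchar (translate x \<xi>)"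
proof -
  obtain v where v: "v \<in> carrier_vec m" "v \<noteq> 0\<^sub>v m" "\<And>g. g \<in> L \<Longrightarrow> \<rho> g *\<^sub>v v = \<xi> g \<cdot>\<^sub>v v"
    using xi unfolding eigenchar_def by blast
  have "\<rho> g *\<^sub>v (\<rho> x *\<^sub>v v) = translate x \<xi> g \<cdot>\<^sub>v (\<rho> x *\<^sub>v v)" if g: "g \<in> L" for g
  proof -
    have c: "\<rho> g \<in> carrier_mat m m" "\<rho> x \<in> carrier_mat m m"
      using rho_carrier L_carrier g x by auto
    have "\<rho> g *\<^sub>v (\<rho> x *\<^sub>v v) = (\<rho> g * \<rho> x) *\<^sub>v v" using c v by simp
    also have "\<dots> = commutator_form g x \<cdot>\<^sub>v ((\<rho> x * \<rho> g) *\<^sub>v v)"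
      unfolding rho_swap[OF L_carrier[OF g] x] using c v by (intro smult_mat_mult_vec[of _ m m]) auto
    also have "(\<rho> x * \<rho> g) *\<^sub>v v = \<xi> g \<cdot>\<^sub>v (\<rho> x *\<^sub>v v)"
      using c v g by (simp add: mult_mat_vec)
    finally show ?thesis using g by (simp add: translate_def smult_smult_assoc)
  qed
  then show ?thesis
    using rho_mult_vec_nonzero[OF x v(1,2)] rho_carrier[OF x] v(1) unfolding eigenchar_def
    by (intro conjI bexI[of _ "\<rho> x *\<^sub>v v"]) (auto simp: translate_def)
qed

lemma translate_translate:
  "x \<in> carrier G \<Longrightarrow> y \<in> carrier G \<Longrightarrow> translate x (translate y \<xi>) = translate (x \<otimes> y) \<xi>"
  unfolding translate_def by (intro restrict_ext) (simp add: L_carrier commutator_form_mult_right)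

lemma translate_one:
  assumes "eigenchar \<xi>"
  shows "translate \<one> \<xi> = \<xi>"
proof (rule extensionalityI[of _ L])
  show "translate \<one> \<xi> g = \<xi> g" if g: "g \<in> L" for g
    using commutator_form_mult_right[of g \<one> \<one>] commutator_form_nonzero[of g \<one>] L_carrier[OF g] g
    by (simp add: translate_def)
  show "\<xi> \<in> extensional L" using assms unfolding eigenchar_def by blast
qed (simp add: translate_def)

lemma translate_inv:
  "eigenchar \<xi> \<Longrightarrow> x \<in> carrier G \<Longrightarrow> translate (inv x) (translate x \<xi>) = \<xi>"
  by (simp add: translate_translate translate_one)

text \<open>Freeness of the action of \<open>G / L\<close>: as \<open>\<xi>\<close> vanishes nowhere
  on \<open>L\<close>, equal translates make \<open>x \<otimes> inv y\<close> orthogonal to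
  \<open>L\<close>, and maximality applies.\<close>

lemma translate_eqD:
  assumes xi: "eigenchar \<xi>" and x: "x \<in> carrier G" and y: "y \<in> carrier G"
    and eq: "translate x \<xi> = translate y \<xi>"
  shows "x \<otimes> inv y \<in> L"
proof (rule maximal)
  fix g assume g: "g \<in> L"
  have "commutator_form g x = commutator_form g y"
    using fun_cong[OF eq, of g] g eigenchar_nonzero[OF xi g] by (simp add: translate_def)
  moreover have "x = (x \<otimes> inv y) \<otimes> y" using x y by (simp add: m_assoc)
  then have "commutator_form g x = commutator_form g (x \<otimes> inv y) * commutator_form g y"
    using commutator_form_mult_right[of g "x \<otimes> inv y" y] x y L_carrier[OF g] by simp
  ultimately show "commutator_form g (x \<otimes> inv y) = 1"
    using commutator_form_nonzero[OF L_carrier[OF g] y] by simp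
qed (use x y in simp)

text \<open>The choice depends only on the orbit as a set, so all functions in one orbit get the
  same representative.\<close>

definition orbit_rep :: "('a \<Rightarrow> complex) \<Rightarrow> 'a \<Rightarrow> complex" where
  "orbit_rep \<xi> = (SOME \<mu>. \<exists>x\<in>carrier G. \<mu> = translate x \<xi>)"

definition orbit_reps :: "('a \<Rightarrow> complex) set" where
  "orbit_reps = orbit_rep ` {\<xi>. eigenchar \<xi>}"

lemma orbit_rep_translate_ex: "\<exists>x\<in>carrier G. orbit_rep \<xi> = translate x \<xi>"
  unfolding orbit_rep_def
  by (rule someI_ex[of "\<lambda>\<mu>. \<exists>x\<in>carrier G. \<mu> = translate x \<xi>"]) blast

lemma orbit_rep_translate:
  assumes "x \<in> carrier G"
  shows "orbit_rep (translate x \<xi>) = orbit_rep \<xi>"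
proof -
  have "(\<exists>y\<in>carrier G. \<mu> = translate y (translate x \<xi>)) \<longleftrightarrow> (\<exists>y\<in>carrier G. \<mu> = translate y \<xi>)" for \<mu>
  proof
    assume "\<exists>y\<in>carrier G. \<mu> = translate y (translate x \<xi>)"
    then show "\<exists>y\<in>carrier G. \<mu> = translate y \<xi>"
      using assms by (metis translate_translate m_closed)
  next
    assume "\<exists>y\<in>carrier G. \<mu> = translate y \<xi>"
    then obtain y where y: "y \<in> carrier G" "\<mu> = translate y \<xi>" by blast
    then have "\<mu> = translate (y \<otimes> inv x) (translate x \<xi>)"
      using assms by (simp add: translate_translate m_assoc)
    then show "\<exists>y\<in>carrier G. \<mu> = translate y (translate x \<xi>)"
      using y assms by (intro bexI[of _ "y \<otimes> inv x"]) auto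
  qed
  then show ?thesis unfolding orbit_rep_def by simp
qed

lemma eigenchar_orbit_rep: "eigenchar \<xi> \<Longrightarrow> eigenchar (orbit_rep \<xi>)"
  using orbit_rep_translate_ex[of \<xi>] eigenchar_translate[of _ \<xi>] by fastforce

lemma finite_orbit_reps: "finite orbit_reps"
  unfolding orbit_reps_def using finite_eigenchars by simp

lemma orbit_reps_props:
  assumes "\<mu> \<in> orbit_reps"
  shows "eigenchar \<mu>" "orbit_rep \<mu> = \<mu>"
proof -
  obtain \<xi> where xi: "eigenchar \<xi>" "\<mu> = orbit_rep \<xi>"
    using assms unfolding orbit_reps_def by blast
  then show "eigenchar \<mu>" using eigenchar_orbit_rep by simp
  obtain x where "x \<in> carrier G" "orbit_rep \<xi> = translate x \<xi>"
    using orbit_rep_translate_ex by blast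
  then show "orbit_rep \<mu> = \<mu>" using orbit_rep_translate[of x \<xi>] xi(2) by simp
qed

text \<open>By freeness each orbit has as many functions as \<open>L\<close> has cosets, and there
  are at most \<open>m\<close> functions in total. Counting pairs avoids the quotient group.\<close>

lemma card_carrier_mult_orbit_reps_le: "card (carrier G) * card orbit_reps \<le> m * card L"
proof -
  let ?E = "{\<xi>. eigenchar \<xi>}"
  have "\<exists>x\<in>carrier G. \<xi> = translate x (orbit_rep \<xi>)" if "eigenchar \<xi>" for \<xi>
    using orbit_rep_translate_ex[of \<xi>] translate_inv[OF that] by (metis inv_closed)
  then obtain b where b: "\<And>\<xi>. eigenchar \<xi> \<Longrightarrow> b \<xi> \<in> carrier G \<and> \<xi> = translate (b \<xi>) (orbit_rep \<xi>)"
    by metis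
  \<comment> \<open>The first component determines \<open>\<mu>\<close> and the chosen value of
    \<open>b\<close>; the second is the deviation of \<open>x\<close> from that value, an element of
    \<open>L\<close> by freeness.\<close>
  let ?f = "\<lambda>(x, \<mu>). (translate x \<mu>, x \<otimes> inv (b (translate x \<mu>)))"
  have rep: "orbit_rep (translate x \<mu>) = \<mu>" if "x \<in> carrier G" "\<mu> \<in> orbit_reps" for x \<mu>
    using that orbit_rep_translate orbit_reps_props by simp
  have "inj_on ?f (carrier G \<times> orbit_reps)"
  proof (rule inj_onI, clarify)
    fix x \<mu> y \<nu>
    assume *: "x \<in> carrier G" "\<mu> \<in> orbit_reps" "y \<in> carrier G" "\<nu> \<in> orbit_reps"
      "translate x \<mu> = translate y \<nu>"
      "x \<otimes> inv b (translate x \<mu>) = y \<otimes> inv b (translate y \<nu>)"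
    have "\<mu> = \<nu>" using rep[OF *(1,2)] rep[OF *(3,4)] *(5) by simp
    moreover have "b (translate x \<mu>) \<in> carrier G"
      using b eigenchar_translate[OF *(1)] orbit_reps_props[OF *(2)] by blast
    then have "x = y" using * by simp
    ultimately show "x = y \<and> \<mu> = \<nu>" by blast
  qed
  moreover have "?f ` (carrier G \<times> orbit_reps) \<subseteq> ?E \<times> L"
  proof clarify
    fix x \<mu> assume *: "x \<in> carrier G" "\<mu> \<in> orbit_reps"
    have e: "eigenchar (translate x \<mu>)"
      using eigenchar_translate[OF *(1)] orbit_reps_props[OF *(2)] by blast
    then have "translate x \<mu> = translate (b (translate x \<mu>)) \<mu>" "b (translate x \<mu>) \<in> carrier G"
      using b[OF e] rep[OF *] by simp_all
    then show "translate x \<mu> \<in> ?E \<and> x \<otimes> inv b (translate x \<mu>) \<in> L"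
      using translate_eqD[OF orbit_reps_props(1)[OF *(2)] *(1)] e by blast
  qed
  ultimately have "card (carrier G \<times> orbit_reps) \<le> card (?E \<times> L)"
    using finite_eigenchars finite_L by (intro card_inj_on_le[of ?f]) auto
  also have "\<dots> \<le> m * card L"
    using card_eigenchars_le[OF finite_eigenchars] by (simp add: card_cartesian_product)
  finally show ?thesis by (simp add: card_cartesian_product)
qed

section \<open>Bounds from separating the elements of \<open>L\<close>\<close>

lemma orbit_reps_nonempty:
  assumes "m \<ge> 1"
  shows "orbit_reps \<noteq> {}"
proof -
  have "\<one> \<in> L" using subgroup_L by (rule subgroup.one_closed)
  moreover have "unit_vec m 0 \<noteq> (0\<^sub>v m :: complex vec)"
    using assms by (auto dest: arg_cong[of _ _ "\<lambda>v. v $ 0"])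
  ultimately have "\<exists>\<xi>. eigenchar \<xi> \<and> \<xi> \<one> = 1"
    by (intro exists_eigenchar[of _ "unit_vec m 0"]) (auto simp: rho_one)
  then show ?thesis unfolding orbit_reps_def by blast
qed

text \<open>Being orthogonal to \<open>L\<close> and \<open>S\<close>, the element \<open>g\<close>
  is orthogonal to \<open>G\<close>, so translation does not change values at \<open>g\<close>.
  Agreement on representatives thus passes to all eigenvalue functions, and \<open>\<rho> g\<close>
  is scalar.\<close>

lemma L_separated:
  assumes faithful: "faithful_proj_rep G m \<rho>"
    and S: "S \<subseteq> carrier G" "generate G (L \<union> S) = carrier G"
    and g: "g \<in> L" and gS: "\<And>s. s \<in> S \<Longrightarrow> commutator_form g s = 1"
    and gR: "\<And>\<mu>. \<mu> \<in> orbit_reps \<Longrightarrow> \<mu> g = c"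
  shows "g = \<one>"
proof -
  have char: "complex_char_on G (carrier G) (commutator_form g)"
    using L_carrier[OF g] by (simp add: complex_char_on_def commutator_form_nonzero commutator_form_mult_right)
  have gx: "commutator_form g x = 1" if "x \<in> carrier G" for x
  proof (rule complex_char_trivial_if_trivial_on_generators[OF char _ S(2) _ that])
    show "L \<union> S \<subseteq> carrier G" using S(1) L_subset by blast
    show "commutator_form g s = 1" if "s \<in> L \<union> S" for s
      using that gS isotropic[OF g] by blast
  qed
  have "\<xi> g = c" if xi: "eigenchar \<xi>" for \<xi>
  proof -
    obtain x where x: "x \<in> carrier G" "orbit_rep \<xi> = translate x \<xi>"
      using orbit_rep_translate_ex by blast
    have "orbit_rep \<xi> g = \<xi> g" using x g gx by (simp add: translate_def)
    moreover have "orbit_rep \<xi> \<in> orbit_reps" using xi by (simp add: orbit_reps_def)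
    ultimately show ?thesis using gR by simp
  qed
  then have "\<exists>c. \<rho> g = c \<cdot>\<^sub>m 1\<^sub>m m"
    by (intro scalar_if_eigenchars_agree[OF g]) metis
  then show ?thesis using faithful L_carrier[OF g] unfolding faithful_proj_rep_def by blast
qed

text \<open>The commutator characters of \<open>S\<close> and the quotients of representatives
  separate \<open>L\<close>, which bounds the number of generators of \<open>L\<close>. Adding
  \<open>S\<close> to generate \<open>G\<close> counts \<open>card S\<close> a second time.\<close>

lemma group_rank_le_complement:
  assumes faithful: "faithful_proj_rep G m \<rho>" and m: "m \<ge> 1"
    and S: "S \<subseteq> carrier G" "finite S" "generate G (L \<union> S) = carrier G"
  shows "group_rank G \<le> 2 * card S + (card orbit_reps - 1)"
proof -
  obtain \<xi> where xi: "\<xi> \<in> orbit_reps" using orbit_reps_nonempty[OF m] by blast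
  define C1 where "C1 = (\<lambda>s g. commutator_form g s) ` S"
  \<comment> \<open>Triviality of these quotients at \<open>g\<close> says that all representatives
    agree there; the quotient of \<open>\<xi>\<close> by itself is left out, whence the subtracted
    1.\<close>
  define C2 where "C2 = (\<lambda>\<mu> g. \<mu> g / \<xi> g) ` (orbit_reps - {\<xi>})"
  have "\<exists>T. T \<subseteq> L \<and> finite T \<and> card T \<le> card (C1 \<union> C2) \<and> generate G T = L"
  proof (rule generated_by_card_separating_chars[OF _ finite_L subgroup_L])
    show "finite (C1 \<union> C2)" using S(2) finite_orbit_reps by (simp add: C1_def C2_def)
    show "complex_char_on G L \<chi>" if "\<chi> \<in> C1 \<union> C2" for \<chi>
      using that
    proof
      assume "\<chi> \<in> C1"
      then obtain s where s: "s \<in> S" "\<chi> = (\<lambda>g. commutator_form g s)" by (auto simp: C1_def)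
      then have "s \<in> carrier G" using S(1) by blast
      then show ?thesis
        unfolding s(2) by (intro complex_char_on_subset[OF commutator_form_char L_subset])
    next
      assume "\<chi> \<in> C2"
      then show ?thesis using eigenchar_quotient_char orbit_reps_props(1) xi by (auto simp: C2_def)
    qed
    show "g = \<one>" if g: "g \<in> L" and 1: "\<And>\<chi>. \<chi> \<in> C1 \<union> C2 \<Longrightarrow> \<chi> g = 1" for g
    proof (rule L_separated[OF faithful S(1,3) g])
      show "commutator_form g s = 1" if "s \<in> S" for s
        using 1[of "\<lambda>g. commutator_form g s"] that by (auto simp: C1_def)
      show "\<mu> g = \<xi> g" if "\<mu> \<in> orbit_reps" for \<mu>
        using 1[of "\<lambda>g. \<mu> g / \<xi> g"] that by (cases "\<mu> = \<xi>") (auto simp: C2_def)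
    qed
  qed
  then obtain T where T: "T \<subseteq> L" "finite T" "card T \<le> card (C1 \<union> C2)" "generate G T = L" by blast
  have "card C1 \<le> card S" unfolding C1_def using S(2) by (rule card_image_le)
  moreover have "card C2 \<le> card (orbit_reps - {\<xi>})"
    unfolding C2_def using finite_orbit_reps by (intro card_image_le) simp
  ultimately have cT: "card T \<le> card S + (card orbit_reps - 1)"
    using T(3) card_Un_le[of C1 C2] xi finite_orbit_reps by simp
  have TS: "T \<union> S \<subseteq> carrier G" using T(1) L_subset S(1) by blast
  have "L \<union> S \<subseteq> generate G (T \<union> S)"
    using T(4) mono_generate[of T "T \<union> S"] by (auto intro: generate.incl)
  then have "generate G (L \<union> S) \<subseteq> generate G (T \<union> S)"
    using TS by (intro generate_subgroup_incl generate_is_subgroup)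
  then have "generate G (T \<union> S) = carrier G" using S(3) generate_incl[OF TS] by simp
  then have "group_rank G \<le> card (T \<union> S)" using T(2) S(2) TS by (intro group_rank_le) auto
  also have "\<dots> \<le> card T + card S" by (rule card_Un_le)
  finally show ?thesis using cT by linarith
qed

text \<open>With a single orbit, the values \<open>commutator_form g s\<close> for \<open>s\<close>
  in \<open>S\<close> determine \<open>g\<close>, and each is a sign because
  \<open>s \<otimes> s\<close> lies in \<open>L\<close>.\<close>

lemma card_L_le:
  assumes faithful: "faithful_proj_rep G m \<rho>" and m: "m \<ge> 1"
    and one_orbit: "card orbit_reps = 1"
    and S: "S \<subseteq> carrier G" "finite S" "generate G (L \<union> S) = carrier G"
    and sq: "\<And>s. s \<in> S \<Longrightarrow> s \<otimes> s \<in> L"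
  shows "card L \<le> 2 ^ card S"
proof -
  let ?f = "\<lambda>g. \<lambda>s\<in>S. commutator_form g s"
  obtain \<xi> where xi: "orbit_reps = {\<xi>}" using one_orbit by (metis card_1_singletonE)
  have "inj_on ?f L"
  proof (rule inj_onI)
    fix g h assume *: "g \<in> L" "h \<in> L" "?f g = ?f h"
    have gh: "g \<otimes> inv h \<in> L"
      using * subgroup_L by (simp add: subgroup.m_closed subgroup.m_inv_closed)
    have "commutator_form (g \<otimes> inv h) s = 1" if s: "s \<in> S" for s
    proof -
      have sG: "s \<in> carrier G" using s S(1) by blast
      have "commutator_form g s = commutator_form h s"
        using fun_cong[OF *(3), of s] s by simp
      then show ?thesis
        using complex_char_on_inv[OF commutator_form_char[OF sG] subgroup_self L_carrier[OF *(2)]]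
          * L_carrier sG commutator_form_nonzero by (simp add: commutator_form_mult_left)
    qed
    moreover have "\<mu> (g \<otimes> inv h) = \<xi> (g \<otimes> inv h)" if "\<mu> \<in> orbit_reps" for \<mu>
      using that xi by simp
    ultimately have "g \<otimes> inv h = \<one>"
      by (rule L_separated[OF faithful S(1,3) gh])
    then show "g = h" using *(1,2) L_carrier
      by (metis inv_equality inv_closed inv_inv)
  qed
  moreover have "?f ` L \<subseteq> S \<rightarrow>\<^sub>E {1, -1}"
  proof -
    have "commutator_form g s \<in> {1, -1}" if g: "g \<in> L" and s: "s \<in> S" for g s
    proof -
      have "commutator_form g s * commutator_form g s = commutator_form g (s \<otimes> s)"
        using L_carrier[OF g] s S(1) by (intro commutator_form_mult_right[symmetric]) auto
      also have "\<dots> = 1" using sq[OF s] isotropic[OF g] by blast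
      finally show ?thesis by (simp add: square_eq_1_iff)
    qed
    then show ?thesis unfolding image_subset_iff restrict_PiE_iff by blast
  qed
  moreover have "finite (S \<rightarrow>\<^sub>E {1, -1::complex})"
    using S(2) by (intro finite_PiE) simp_all
  ultimately have "card L \<le> card (S \<rightarrow>\<^sub>E {1, -1::complex})"
    by (rule card_inj_on_le)
  also have "\<dots> = 2 ^ card S" using S(2) by (simp add: card_PiE numeral_2_eq_2)
  finally show ?thesis .
qed

end

lemma power_two_mult_le_imp:
  fixes a r :: nat
  assumes "2 ^ a * r \<le> 2 * a + (r - 1)" "r \<ge> 1"
  shows "r = 1 \<and> 2 ^ a = 2 * a"
proof -
  \<comment> \<open>From \<open>a = 3\<close> on the exponential dominates. Among the rest,
    \<open>a = 0\<close> is impossible, while \<open>a = 1\<close> and \<open>a = 2\<close> force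
    \<open>r = 1\<close>.\<close>
  have "2 * a + 2 \<le> 2 ^ a" if "a \<ge> 3" for a :: nat
    using that by (induction a rule: dec_induct) auto
  moreover have "(2 * a + 2) * r > 2 * a + (r - 1)"
    using assms(2) by (cases r) auto
  ultimately have "\<not> a \<ge> 3"
    using assms(1) mult_le_mono1[of "2 * a + 2" "2 ^ a" r] by (meson leD le_trans)
  then consider "a = 0" | "a = 1" | "a = 2" by linarith
  then show ?thesis using assms by cases auto
qed

lemma (in comm_proj_rep) faithful_degree_ge:
  assumes faithful: "faithful_proj_rep G m \<rho>" and m: "m \<ge> 1"
    and not_elem: "\<not> elementary_abelian G"
  shows "m \<ge> group_rank G + 1"
proof (rule ccontr)
  assume "\<not> ?thesis"
  then have mn: "m \<le> group_rank G" by simp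
  obtain L where "L \<subseteq> carrier G" "\<forall>g\<in>L. \<forall>h\<in>L. commutator_form g h = 1"
    "\<forall>x\<in>carrier G. (\<forall>g\<in>L. commutator_form g x = 1) \<longrightarrow> x \<in> L"
    using exists_maximal_isotropic by blast
  then interpret lagrangian_proj_rep G m \<alpha> \<rho> L
    by unfold_locales auto
  define r where "r = card orbit_reps"
  have r: "r \<ge> 1"
    using orbit_reps_nonempty[OF m] finite_orbit_reps by (simp add: r_def card_gt_0_iff Suc_le_eq)
  have Gr: "card (carrier G) * r \<le> m * card L"
    unfolding r_def by (rule card_carrier_mult_orbit_reps_le)
  have Lpos: "card L > 0"
    using finite_L subgroup.one_closed[OF subgroup_L] by (auto simp: card_gt_0_iff)
  obtain S where S: "S \<subseteq> carrier G" "finite S" "generate G (L \<union> S) = carrier G"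
    "card L * 2 ^ card S \<le> card (carrier G)"
    using exists_small_complement_generators[OF finite_carrier subgroup_L] by blast
  define a where "a = card S"
  have n: "group_rank G \<le> 2 * a + (r - 1)"
    unfolding a_def r_def by (rule group_rank_le_complement[OF faithful m S(1-3)])
  \<comment> \<open>Cancelling \<open>card L\<close> gives \<open>2 ^ a * r \<le> m\<close>, to be
    compared with the assumed \<open>m \<le> group_rank G\<close> and the bound
    \<open>n\<close>.\<close>
  have "card L * (2 ^ a * r) \<le> card (carrier G) * r"
    using mult_le_mono1[OF S(4), of r] by (simp add: a_def mult.assoc)
  also note Gr
  finally have "2 ^ a * r \<le> m" using Lpos by (simp add: mult.commute)
  then have ra: "r = 1" "2 ^ a = 2 * a" and m_ge: "2 ^ a * r \<le> m"
    using power_two_mult_le_imp[of a r] mn n r by auto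
  have ma: "m = 2 ^ a" "group_rank G = 2 * a" using m_ge mn n ra by auto
  have G_le: "card (carrier G) \<le> 2 ^ a * card L" using Gr ra ma by simp
  \<comment> \<open>A violation would yield generators \<open>T\<close> over \<open>L\<close> with
    \<open>3 * 2 ^ card T \<le> 2 * 2 ^ a\<close>, hence fewer than \<open>a\<close> of them,
    although the rank is \<open>2 * a\<close>.\<close>
  have sq: "s \<otimes> s \<in> L" if s: "s \<in> carrier G" for s
  proof (rule ccontr)
    assume "s \<otimes> s \<notin> L"
    then obtain T where T: "T \<subseteq> carrier G" "finite T" "generate G (L \<union> T) = carrier G"
      "3 * card L * 2 ^ card T \<le> 2 * card (carrier G)"
      using exists_small_complement_generators_order_3[OF finite_carrier subgroup_L s] by blast
    have "card L * (3 * 2 ^ card T) = 3 * card L * 2 ^ card T" by simp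
    also note T(4)
    also have "2 * card (carrier G) \<le> 2 * (2 ^ a * card L)" using G_le by (rule mult_le_mono2)
    also have "\<dots> = card L * (2 * 2 ^ a)" by simp
    finally have 3: "3 * 2 ^ card T \<le> 2 * (2::nat) ^ a"
      using Lpos unfolding mult_le_cancel1 by blast
    have "group_rank G \<le> 2 * card T"
      using group_rank_le_complement[OF faithful m T(1-3)] ra by (simp add: r_def)
    then have "(2::nat) ^ a \<le> 2 ^ card T" using ma by (intro power_increasing) auto
    then have "3 * (2::nat) ^ a \<le> 2 * 2 ^ a" using 3 by linarith
    then show False by simp
  qed
  \<comment> \<open>Now both factors in \<open>G_le\<close> are at most \<open>2 ^ a\<close>, so the
    order of \<open>G\<close> is at most \<open>2 ^ group_rank G\<close>.\<close>
  have "card L \<le> 2 ^ a"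
    unfolding a_def using ra S sq by (intro card_L_le[OF faithful m]) (auto simp: r_def)
  then have "card (carrier G) \<le> 2 ^ a * 2 ^ a"
    using G_le by (meson le_trans mult_le_mono2)
  also have "\<dots> = 2 ^ group_rank G" unfolding ma(2) by (simp add: mult_2 power_add)
  finally show False using elementary_abelian_if_card_le[OF finite_carrier] not_elem by blast
qed

subsection \<open>The upper bound\<close>

lemma (in group) proj_rep_if_linear_rep:
  assumes carr: "\<And>g. g \<in> carrier G \<Longrightarrow> \<rho> g \<in> carrier_mat N N"
    and one: "\<rho> \<one> = 1\<^sub>m N"
    and mult: "\<And>g h. g \<in> carrier G \<Longrightarrow> h \<in> carrier G \<Longrightarrow> \<rho> g * \<rho> h = \<rho> (g \<otimes> h)"
  shows "proj_rep G N (\<lambda>_ _. 1) \<rho>"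
proof -
  have "invertible_mat (\<rho> g)" if g: "g \<in> carrier G" for g
  proof -
    have "\<rho> g * \<rho> (inv g) = 1\<^sub>m N" "\<rho> (inv g) * \<rho> g = 1\<^sub>m N"
      using mult[of g "inv g"] mult[of "inv g" g] g one by simp_all
    moreover have "dim_row (\<rho> g) = N" "dim_col (\<rho> g) = N" "dim_row (\<rho> (inv g)) = N"
      using carr[OF g] carr[OF inv_closed[OF g]] by auto
    ultimately show ?thesis
      unfolding invertible_mat_def inverts_mat_def square_mat.simps by metis
  qed
  moreover have "1 \<cdot>\<^sub>m A = A" for A :: "complex mat"
    by (intro eq_matI) auto
  ultimately show ?thesis
    unfolding proj_rep_def using assms by simp
qed

section \<open>The regular representation and separating characters\<close>

definition regular_rep :: "('a, 'b) monoid_scheme \<Rightarrow> (nat \<Rightarrow> 'a) \<Rightarrow> 'a \<Rightarrow> complex mat" where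
  "regular_rep G f g = Matrix.mat (card (carrier G)) (card (carrier G))
     (\<lambda>(i, j). if f i = g \<otimes>\<^bsub>G\<^esub> f j then 1 else 0)"

lemma (in comm_group) proj_rep_regular_rep:
  assumes f: "bij_betw f {..<card (carrier G)} (carrier G)"
  shows "proj_rep G (card (carrier G)) (\<lambda>_ _. 1) (regular_rep G f)"
proof -
  let ?N = "card (carrier G)"
  have fG: "f i \<in> carrier G" if "i < ?N" for i
    using f that by (auto simp: bij_betw_def)
  have f_inj: "f i = f j \<longleftrightarrow> i = j" if "i < ?N" "j < ?N" for i j
    using f that by (auto simp: bij_betw_def inj_on_def)
  have carr: "regular_rep G f g \<in> carrier_mat ?N ?N" for g by (simp add: regular_rep_def)
  have one: "regular_rep G f \<one> = 1\<^sub>m ?N"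
    by (intro eq_matI) (auto simp: regular_rep_def fG f_inj)
  have mult: "regular_rep G f g * regular_rep G f h = regular_rep G f (g \<otimes> h)"
    if g: "g \<in> carrier G" and h: "h \<in> carrier G" for g h
  proof (rule eq_matI)
    fix i j assume "i < dim_row (regular_rep G f (g \<otimes> h))" "j < dim_col (regular_rep G f (g \<otimes> h))"
    then have ij: "i < ?N" "j < ?N" by (auto simp: regular_rep_def)
    have "h \<otimes> f j \<in> f ` {..<?N}"
      using bij_betw_imp_surj_on[OF f] fG[OF ij(2)] h by simp
    then obtain k0 where k0: "k0 < ?N" "f k0 = h \<otimes> f j"
      by (elim imageE) simp
    have "(regular_rep G f g * regular_rep G f h) $$ (i, j)
      = (\<Sum>k<?N. (if f i = g \<otimes> f k then 1 else 0) * (if f k = h \<otimes> f j then 1 else 0))"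
      using ij by (simp add: regular_rep_def scalar_prod_def atLeast0LessThan)
    also have "\<dots> = (\<Sum>k<?N. if k = k0 then (if f i = g \<otimes> f k then 1 else 0) else 0)"
      using k0(2) f_inj[OF _ k0(1)] by (intro sum.cong) simp_all
    also have "\<dots> = (if f i = g \<otimes> f k0 then 1 else 0)" using k0 by simp
    also have "\<dots> = regular_rep G f (g \<otimes> h) $$ (i, j)"
      using ij g h k0 fG by (simp add: regular_rep_def m_assoc)
    finally show "(regular_rep G f g * regular_rep G f h) $$ (i, j) = regular_rep G f (g \<otimes> h) $$ (i, j)" .
  qed (auto simp: regular_rep_def)
  show ?thesis
    by (rule proj_rep_if_linear_rep[OF carr one mult])
qed

text \<open>The machinery of the lower bound is reused for the regular representation: if every
  character were trivial at \<open>g\<close>, its eigenvalue functions would agree there, making the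
  matrix of \<open>g\<close> scalar.\<close>

lemma (in comm_group) exists_separating_complex_char:
  assumes fin: "finite (carrier G)" and g: "g \<in> carrier G" "g \<noteq> \<one>"
  shows "\<exists>\<chi>. \<chi> \<in> extensional (carrier G) \<and> complex_char_on G (carrier G) \<chi> \<and> \<chi> g \<noteq> 1"
proof (rule ccontr)
  assume contra: "\<not> ?thesis"
  let ?N = "card (carrier G)"
  obtain f where f: "bij_betw f {..<?N} (carrier G)"
    using ex_bij_betw_nat_finite[OF fin] atLeast0LessThan by auto
  interpret comm_proj_rep G ?N "\<lambda>_ _. 1" "regular_rep G f"
    by unfold_locales (use fin proj_rep_regular_rep[OF f] in auto)
  \<comment> \<open>For the trivial cocycle the commutator form is constantly 1, so the whole group
    is maximal isotropic and the eigenvalue functions are genuine characters.\<close>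
  interpret lagrangian_proj_rep G ?N "\<lambda>_ _. 1" "regular_rep G f" "carrier G"
    by unfold_locales (auto simp: commutator_form_def)
  have "\<xi> g = 1" if xi: "eigenchar \<xi>" for \<xi>
  proof -
    have "complex_char_on G (carrier G) \<xi>"
      using eigenchar_nonzero[OF xi] eigenchar_mult[OF xi] by (simp add: complex_char_on_def)
    then show ?thesis using contra xi unfolding eigenchar_def by blast
  qed
  then obtain c where c: "regular_rep G f g = c \<cdot>\<^sub>m 1\<^sub>m ?N"
    using scalar_if_eigenchars_agree[OF g(1)] by metis
  have "g \<in> f ` {..<?N}" "\<one> \<in> f ` {..<?N}"
    using bij_betw_imp_surj_on[OF f] g(1) by simp_all
  then obtain i j where ij: "i < ?N" "j < ?N" "f i = g" "f j = \<one>"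
    by (elim imageE) simp
  then have "i \<noteq> j" using g(2) by auto
  \<comment> \<open>As \<open>g \<otimes> f j = f i\<close>, the off-diagonal entry at
    \<open>(i, j)\<close> is 1, whereas a scalar matrix has 0 there.\<close>
  then show False
    using arg_cong[OF c, of "\<lambda>A. A $$ (i, j)"] ij g(1) by (simp add: regular_rep_def)
qed

section \<open>The dual group and its generators\<close>

definition dual_group :: "('a, 'b) monoid_scheme \<Rightarrow> ('a \<Rightarrow> complex) monoid" where
  "dual_group G = \<lparr>carrier = {\<chi> \<in> extensional (carrier G). complex_char_on G (carrier G) \<chi>},
     monoid.mult = (\<lambda>\<chi> \<psi>. \<lambda>x\<in>carrier G. \<chi> x * \<psi> x), one = (\<lambda>x\<in>carrier G. 1)\<rparr>"

lemma (in comm_group) comm_group_dual_group: "comm_group (dual_group G)"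
proof (rule comm_groupI)
  fix \<chi> assume chi: "\<chi> \<in> carrier (dual_group G)"
  show "\<exists>\<psi>\<in>carrier (dual_group G). \<psi> \<otimes>\<^bsub>dual_group G\<^esub> \<chi> = \<one>\<^bsub>dual_group G\<^esub>"
    using chi by (intro bexI[of _ "\<lambda>x\<in>carrier G. inverse (\<chi> x)"])
      (auto simp: dual_group_def complex_char_on_def cong: restrict_cong)
qed (auto simp: dual_group_def complex_char_on_def extensional_def fun_eq_iff mult_ac)

lemma (in comm_group) finite_dual_group:
  assumes fin: "finite (carrier G)"
  shows "finite (carrier (dual_group G))"
proof (rule finite_subset)
  let ?N = "Coset.order G"
  have "?N > 0" using fin by (auto simp: Coset.order_def card_gt_0_iff)
  then show "finite (carrier G \<rightarrow>\<^sub>E {z::complex. z ^ ?N = 1})"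
    using fin by (intro finite_PiE finite_roots_unity) auto
  have "\<chi> x ^ ?N = 1" if "complex_char_on G (carrier G) \<chi>" "x \<in> carrier G" for \<chi> x
    using complex_char_on_pow[OF that(1) subgroup_self that(2), of ?N] pow_order_eq_1[OF that(2)]
      complex_char_on_one[OF that(1) subgroup_self] by simp
  then show "carrier (dual_group G) \<subseteq> carrier G \<rightarrow>\<^sub>E {z. z ^ ?N = 1}"
    by (auto simp: dual_group_def PiE_def)
qed

text \<open>The evaluations at generators of a group separate its dual, which therefore has
  at most as many generators.\<close>

lemma (in comm_group) exists_rank_separating_chars:
  assumes fin: "finite (carrier G)"
  shows "\<exists>T. finite T \<and> card T \<le> group_rank G \<and> (\<forall>\<chi>\<in>T. complex_char_on G (carrier G) \<chi>)
           \<and> (\<forall>x\<in>carrier G. (\<forall>\<chi>\<in>T. \<chi> x = 1) \<longrightarrow> x = \<one>)"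
proof -
  let ?D = "dual_group G"
  interpret D: comm_group ?D by (rule comm_group_dual_group)
  obtain S where S: "S \<subseteq> carrier G" "finite S" "card S = group_rank G" "generate G S = carrier G"
    using group_rank_generators[OF fin] by blast
  define E where "E = (\<lambda>s \<chi>. \<chi> s :: complex) ` S"
  have char: "complex_char_on ?D (carrier ?D) (\<lambda>\<chi>. \<chi> x)" if "x \<in> carrier G" for x
    using that by (auto simp: complex_char_on_def dual_group_def)
  have "\<exists>T. T \<subseteq> carrier ?D \<and> finite T \<and> card T \<le> card E \<and> generate ?D T = carrier ?D"
  proof (rule D.generated_by_card_separating_chars[OF _ finite_dual_group[OF fin] D.subgroup_self])
    show "finite E" using S(2) by (simp add: E_def)
    show "complex_char_on ?D (carrier ?D) e" if "e \<in> E" for e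
      using that char S(1) by (auto simp: E_def)
    show "\<chi> = \<one>\<^bsub>?D\<^esub>" if chi: "\<chi> \<in> carrier ?D" and 1: "\<And>e. e \<in> E \<Longrightarrow> e \<chi> = 1" for \<chi>
    proof (rule extensionalityI[of _ "carrier G"])
      have chi': "complex_char_on G (carrier G) \<chi>" using chi by (simp add: dual_group_def)
      have "\<chi> s = 1" if "s \<in> S" for s using 1[of "\<lambda>\<chi>. \<chi> s"] that by (auto simp: E_def)
      then show "\<chi> x = \<one>\<^bsub>?D\<^esub> x" if "x \<in> carrier G" for x
        using complex_char_trivial_if_trivial_on_generators[OF chi' S(1,4) _ that] that
        by (simp add: dual_group_def)
    qed (use chi in \<open>auto simp: dual_group_def\<close>)
  qed
  then obtain T where T: "T \<subseteq> carrier ?D" "finite T" "card T \<le> card E" "generate ?D T = carrier ?D"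
    by blast
  have "card E \<le> group_rank G" unfolding E_def using card_image_le[OF S(2)] S(3) by metis
  then have "card T \<le> group_rank G" using T(3) by linarith
  moreover have "x = \<one>" if x: "x \<in> carrier G" and 1: "\<forall>\<chi>\<in>T. \<chi> x = 1" for x
  proof (rule ccontr)
    assume "x \<noteq> \<one>"
    then obtain \<chi> where chi: "\<chi> \<in> carrier ?D" "\<chi> x \<noteq> 1"
      using exists_separating_complex_char[OF fin x] by (auto simp: dual_group_def)
    \<comment> \<open>Evaluation at \<open>x\<close> is a character of the dual group; being trivial
      on the generators \<open>T\<close>, it is trivial everywhere.\<close>
    have "\<chi> x = 1"
      using D.complex_char_trivial_if_trivial_on_generators[OF char[OF x] T(1,4) _ chi(1)] 1 by blast
    then show False using chi(2) by blast
  qed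
  ultimately show ?thesis
    using T(1,2) by (intro exI[of _ T]) (auto simp: dual_group_def)
qed

text \<open>Separating characters are placed on the diagonal. The extra trivial character forces a
  scalar value to be the identity, so that all characters in \<open>T\<close> are trivial
  there.\<close>

lemma (in comm_group) exists_faithful_proj_rep_rank_Suc:
  assumes fin: "finite (carrier G)"
  shows "\<exists>\<alpha> \<rho>. proj_rep G (group_rank G + 1) \<alpha> \<rho> \<and> faithful_proj_rep G (group_rank G + 1) \<rho>"
proof -
  let ?n = "group_rank G"
  obtain T where T: "finite T" "card T \<le> ?n" "\<And>\<chi>. \<chi> \<in> T \<Longrightarrow> complex_char_on G (carrier G) \<chi>"
    "\<And>x. x \<in> carrier G \<Longrightarrow> (\<And>\<chi>. \<chi> \<in> T \<Longrightarrow> \<chi> x = 1) \<Longrightarrow> x = \<one>"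
    using exists_rank_separating_chars[OF fin] by blast
  define k where "k = card T"
  obtain e where e: "bij_betw e {..<k} T"
    using ex_bij_betw_nat_finite[OF T(1)] atLeast0LessThan unfolding k_def by auto
  \<comment> \<open>Since \<open>k\<close> is at most the rank, at least the last of the
    \<open>?n + 1\<close> entries has the default value 1.\<close>
  define d where "d g i = (if i < k then e i g else 1)" for g i
  define \<rho> where "\<rho> g = mat_diag (?n + 1) (d g)" for g
  have char: "complex_char_on G (carrier G) (\<lambda>g. d g i)" for i
    using T(3)[of "e i"] e by (auto simp: d_def complex_char_on_def bij_betw_def)
  have mult: "\<rho> g * \<rho> h = \<rho> (g \<otimes> h)" if "g \<in> carrier G" "h \<in> carrier G" for g h
  proof -
    have "d (g \<otimes> h) = (\<lambda>i. d g i * d h i)"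
      using char that by (intro ext) (simp add: complex_char_on_def)
    then show ?thesis by (simp add: \<rho>_def)
  qed
  have one: "\<rho> \<one> = 1\<^sub>m (?n + 1)"
    using complex_char_on_one[OF char subgroup_self] by (intro eq_matI) (auto simp: \<rho>_def mat_diag_def)
  have carr: "\<rho> g \<in> carrier_mat (?n + 1) (?n + 1)" for g by (simp add: \<rho>_def)
  have "proj_rep G (?n + 1) (\<lambda>_ _. 1) \<rho>"
    by (rule proj_rep_if_linear_rep[OF carr one mult])
  moreover have "faithful_proj_rep G (?n + 1) \<rho>"
    unfolding faithful_proj_rep_def
  proof (intro ballI impI, elim exE)
    fix g c assume g: "g \<in> carrier G" and c: "\<rho> g = c \<cdot>\<^sub>m 1\<^sub>m (?n + 1)"
    have dc: "d g i = c" if "i \<le> ?n" for i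
      using arg_cong[OF c, of "\<lambda>A. A $$ (i, i)"] that by (simp add: \<rho>_def mat_diag_def)
    have "c = 1" using dc[of ?n] T(2) by (simp add: d_def k_def)
    show "g = \<one>"
    proof (rule T(4)[OF g])
      fix \<chi> assume "\<chi> \<in> T"
      then obtain i where "i < k" "\<chi> = e i" using e by (auto simp: bij_betw_def)
      then show "\<chi> g = 1" using dc[of i] T(2) \<open>c = 1\<close> by (simp add: d_def k_def)
    qed
  qed
  ultimately show ?thesis by blast
qed

theorem theorem4p10:
  fixes G :: "('a, 'b) monoid_scheme" and n :: nat
  assumes "comm_group G" and "finite (carrier G)"
    and "group_rank G = n"
    and "\<not> elementary_abelian G"
  shows "tau G = n + 1"
  unfolding tau_def
proof (rule Least_equality)
  interpret comm_group G by fact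
  show "n + 1 \<ge> 1 \<and> (\<exists>\<alpha> \<rho>. proj_rep G (n + 1) \<alpha> \<rho> \<and> faithful_proj_rep G (n + 1) \<rho>)"
    using exists_faithful_proj_rep_rank_Suc assms by simp
  fix m assume "m \<ge> 1 \<and> (\<exists>\<alpha> \<rho>. proj_rep G m \<alpha> \<rho> \<and> faithful_proj_rep G m \<rho>)"
  then obtain \<alpha> \<rho> where m: "m \<ge> 1" "proj_rep G m \<alpha> \<rho>" "faithful_proj_rep G m \<rho>" by blast
  then interpret comm_proj_rep G m \<alpha> \<rho>
    using assms(2) by unfold_locales auto
  show "n + 1 \<le> m" using faithful_degree_ge[OF m(3,1) assms(4)] assms(3) by simp
qed

end
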